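(* The following four identities hold: $$\sum_{k=1}^\infty \frac{(-256)^k \big( (86k^2-21k+2) H_{2k-1} +25k(6k-1)/(2k-1) \big)}{(2k-1)^2 k^3 \binom{3k}{k} \binom{6k}{3k}}= - 8 \pi^4,$$ $$\sum_{k=1}^\infty \frac{(-256)^k \big( (86k^2-21k+2) c_k + 2k(322k-45)/(2k-1) \big)}{(2k-1)^2 k^3 \binom{3k}{k} \binom{6k}{3k}}= - 32 \pi^4,$$ where $c_k = 2H_{6k-1}-H_{3k-1}+H_{k-1}$, $$\sum_{k=1}^\infty \frac{(-256)^k \big( (86k^2-21k+2) H_{2k-1}^{(2)} - 61k(6k-1)/(2k-1)^2 \big)}{(2k-1)^2 k^3 \binom{3k}{k} \binom{6k}{3k}}= 992 \zeta(5),$$ and $$\sum_{k=1}^\infty \frac{(-256)^k \big( (86k^2-21k+2) (15 H_{2k-1}^{(3)} - 2 H_{k-1}^{(3)}) - 83k(6k-1)/(2k-1)^3 \big)}{(2k-1)^2 k^3 \binom{3k}{k} \binom{6k}{3k}} = -1568 \zeta(3)^2.$$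
   Context: For integers $m\ge1$ and $n\ge0$, $H_n^{(m)}=\sum_{0<j\le n}\frac1{j^m}$ denotes the harmonic number of order $m$, and $H_n=H_n^{(1)}$ (so $H_0=H_0^{(m)}=0$). $\zeta$ is the Riemann zeta function. *)

theory Defs
  imports "HOL-Analysis.Analysis"
begin

text \<open>The harmonic number \<open>H\<^bsub>n\<^esub>\<^bsup>(m)\<^esup>\<close> of order \<open>m \<ge> 1\<close>; the order is the first argument.\<close>

definition H :: "nat \<Rightarrow> nat \<Rightarrow> real" where
  "H m n = (\<Sum>j\<in>{0<..n}. 1 / real j ^ m)"

lemma H_1_eq_harm: "H 1 n = harm n"
  by (simp add: H_def harm_def inverse_eq_divide atLeastSucAtMost_greaterThanAtMost[symmetric])

text \<open>The Riemann zeta function on the real half-line \<open>s > 1\<close>, where it is given by its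
  Dirichlet series; the values for \<open>s \<le> 1\<close> are meaningless.\<close>

definition zeta :: "real \<Rightarrow> real" where
  "zeta s = (\<Sum>n. 1 / real (Suc n) powr s)"

end

theory Submission
  imports Defs
begin

text \<open>
  The four series are first-order variations of one accelerated series for \<open>\<zeta>(3)\<close>. Let
  \<open>x = 1/2 + \<alpha>\<close>, \<open>P(t) = t\<^sup>3 - \<sigma> t\<^sup>2 + p t - q\<close> and \<open>Q(t) = - P(\<sigma> - t)\<close>. Moving the parameters of the
  summand of Dougall's bilateral sum \<open>\<^sub>5H\<^sub>5\<close> by integers yields the function

    \<open>F(N,j) = (2x+2N+2j-\<sigma>) \<cdot> \<Prod>\<^sub>1\<^sub>\<le>\<^sub>i\<^sub>\<le>\<^sub>2\<^sub>N P(i) / (2N)! \<cdot> \<Prod>\<^sub>i\<^sub><\<^sub>N\<^sub>+\<^sub>j Q(x+i) / \<Prod>\<^sub>i\<^sub>\<le>\<^sub>N\<^sub>+\<^sub>j P(x+i)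
       \<cdot> \<Gamma>(x+j-N) \<Gamma>(x-\<sigma>) / (\<Gamma>(x) \<Gamma>(x+3N+j+1-\<sigma>))\<close>,

  which for all values of \<open>\<alpha>, \<sigma>, p, q\<close> has a companion \<open>G\<close>, a rational multiple of \<open>F\<close>, with
  \<open>F(N+1,j) - F(N,j) = G(N,j+1) - G(N,j)\<close> (a WZ pair). Summing this relation over the quarter plane
  gives \<open>\<Sum>\<^sub>N G(N,0) = \<Sum>\<^sub>j F(0,j)\<close>: on the left a series whose terms decay like \<open>(16/27)\<^sup>N\<close>, on the
  right an elementary sum over half-integers.

  Only the derivatives at \<open>\<alpha> = \<sigma> = p = q = 0\<close> matter. There \<open>F\<close> becomes the explicit function
  \<open>seed\<close>, and a derivative of \<open>F\<close> is \<open>F \<cdot> L\<close> for a logarithmic derivative \<open>L\<close> that consists of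
  harmonic sums; the derivative of \<open>G\<close> is \<open>F \<cdot> (c L + g)\<close> with rational functions \<open>c\<close> and \<open>g\<close>. So
  the differentiated pair is again a WZ pair, and this can be verified without any parameters:
  the increments of \<open>L\<close> are rational, and what remains are the identities between rational functions
  \<open>seed_wz_ratio\<close>, \<open>weightH1_wz_ratio\<close>, \<open>weightC_wz_ratio\<close>, \<open>weightH2_wz_ratio\<close> and
  \<open>weightH3_wz_ratio\<close>. The directions \<open>- \<partial>\<^sub>\<alpha> - \<partial>\<^sub>\<sigma>\<close>, \<open>- \<partial>\<^sub>\<alpha>\<close>, \<open>\<partial>\<^sub>p\<close> and \<open>\<partial>\<^sub>q\<close> give the weights
  \<open>weightH1\<close>, \<open>weightC\<close>, \<open>weightH2\<close> and \<open>weightH3\<close>. At \<open>j = 0\<close> these are the harmonic numbers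
  \<open>H\<^sub>2\<^sub>k\<^sub>-\<^sub>1\<close>, \<open>c\<^sub>k - 2 H\<^sub>2\<^sub>k\<^sub>-\<^sub>1\<close>, \<open>H\<^sub>2\<^sub>k\<^sub>-\<^sub>1\<close> of order 2, and the combination of order 3, with
  \<open>k = N + 1\<close> and up to rational terms.

  The sums on the line \<open>N = 0\<close> are, with \<open>y\<close> running over \<open>1/2, 3/2, \<dots>\<close>, the values
  \<open>3 \<Sum> y\<^bsup>-4\<^esup> = \<pi>\<^sup>4/2\<close>, \<open>6 \<Sum> y\<^bsup>-4\<^esup> = \<pi>\<^sup>4\<close>, \<open>- 2 \<Sum> y\<^bsup>-5\<^esup> = - 62 \<zeta>(5)\<close> and
  \<open>2 (\<Sum> y\<^bsup>-3\<^esup>)\<^sup>2 = 98 \<zeta>(3)\<^sup>2\<close>. The series of the theorem are \<open>- 16\<close> times the series \<open>\<Sum>\<^sub>N G(N,0)\<close>.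
\<close>

section \<open>Partial sums of a WZ pair over a rectangle\<close>

lemma wz_rectangle:
  fixes F G :: "nat \<Rightarrow> nat \<Rightarrow> real"
  assumes wz: "\<And>N j. F (Suc N) j - F N j = G N (Suc j) - G N j"
  shows "(\<Sum>N<M. G N 0) = (\<Sum>j<J. F 0 j) - (\<Sum>j<J. F M j) + (\<Sum>N<M. G N J)"
proof -
  have cols: "F M j - F 0 j = (\<Sum>N<M. F (Suc N) j - F N j)" for j
    by (rule sum_lessThan_telescope[symmetric])
  have rows: "G N J - G N 0 = (\<Sum>j<J. G N (Suc j) - G N j)" for N
    by (rule sum_lessThan_telescope[symmetric])
  have "(\<Sum>j<J. F M j - F 0 j) = (\<Sum>N<M. G N J - G N 0)"
    unfolding cols rows wz by (rule sum.swap)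
  then show ?thesis by (simp add: sum_subtractf)
qed

lemma sum_inverse_consecutive_le:
  "(\<Sum>j<J. 1 / ((real j + 1) * (real j + 2))) \<le> 1"
proof -
  have "(\<Sum>j<J. 1 / ((real j + 1) * (real j + 2))) = 1 - 1 / (real J + 1)"
  proof (induction J)
    case (Suc J)
    have "1 - 1 / (real J + 1) + 1 / ((real J + 1) * (real J + 2)) = 1 - 1 / (real (Suc J) + 1)"
      by (simp add: divide_simps) (simp add: algebra_simps)
    then show ?case by (simp only: sum.lessThan_Suc Suc.IH)
  qed simp
  then show ?thesis by simp
qed

text \<open>
  Let the rectangle of \<open>wz_rectangle\<close> grow first in \<open>j\<close> and then in \<open>N\<close>: the right edge disappears
  because \<open>G\<close> tends to \<open>0\<close> along each row, and the top edge because \<open>F N\<close> has a summable majorant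
  proportional to \<open>b N\<close>. The bound is only asked for \<open>N \<ge> 1\<close>; on the line \<open>N = 0\<close>, where \<open>F\<close> decays
  more slowly in the applications, convergence is part of the hypothesis on \<open>S\<close>.
\<close>

lemma wz_sums:
  fixes F G :: "nat \<Rightarrow> nat \<Rightarrow> real"
  assumes wz: "\<And>N j. F (Suc N) j - F N j = G N (Suc j) - G N j"
    and G0: "\<And>N. (\<lambda>j. G N j) \<longlonglongrightarrow> 0"
    and bound: "\<And>N j. N \<ge> 1 \<Longrightarrow> \<bar>F N j\<bar> \<le> b N / ((real j + 1) * (real j + 2))"
    and b: "b \<longlonglongrightarrow> 0"
    and S: "(\<lambda>j. F 0 j) sums S"
  shows "(\<lambda>N. G N 0) sums S"
proof -
  have le: "\<bar>(\<Sum>N<M. G N 0) - S\<bar> \<le> \<bar>b M\<bar>" if M: "M \<ge> 1" for M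
  proof -
    have "(\<lambda>J. \<bar>(\<Sum>N<M. G N 0) - (\<Sum>j<J. F 0 j) - (\<Sum>N<M. G N J)\<bar>)
            \<longlonglongrightarrow> \<bar>(\<Sum>N<M. G N 0) - S - (\<Sum>N<M. 0)\<bar>"
      using S by (intro tendsto_intros G0) (simp add: sums_def)
    moreover have "\<bar>(\<Sum>N<M. G N 0) - (\<Sum>j<J. F 0 j) - (\<Sum>N<M. G N J)\<bar> \<le> \<bar>b M\<bar>" for J
    proof -
      have "\<bar>\<Sum>j<J. F M j\<bar> \<le> (\<Sum>j<J. b M / ((real j + 1) * (real j + 2)))"
        by (rule order_trans[OF sum_abs sum_mono]) (rule bound[OF M])
      also have "\<dots> = b M * (\<Sum>j<J. 1 / ((real j + 1) * (real j + 2)))"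
        by (simp add: sum_distrib_left)
      also have "\<dots> \<le> \<bar>b M\<bar> * 1"
        by (intro mult_mono sum_inverse_consecutive_le) (auto intro!: sum_nonneg)
      finally show ?thesis by (simp add: wz_rectangle[of F G, OF wz, of M J])
    qed
    ultimately show ?thesis
      by (intro LIMSEQ_le_const2[of _ "\<bar>(\<Sum>N<M. G N 0) - S\<bar>"]) auto
  qed
  have "(\<lambda>M. (\<Sum>N<M. G N 0) - S) \<longlonglongrightarrow> 0"
  proof (rule Lim_null_comparison)
    show "\<forall>\<^sub>F M in sequentially. norm ((\<Sum>N<M. G N 0) - S) \<le> \<bar>b M\<bar>"
      using eventually_ge_at_top[of 1] by eventually_elim (simp add: le)
    show "(\<lambda>M. \<bar>b M\<bar>) \<longlonglongrightarrow> 0" using b by (rule tendsto_rabs_zero)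
  qed
  then show ?thesis by (simp add: sums_def LIM_zero_iff)
qed

section \<open>The undifferentiated seed\<close>

definition half :: "nat \<Rightarrow> real" where
  "half j = real j + 1 / 2"

text \<open>
  The parametric \<open>F\<close> at \<open>\<alpha> = \<sigma> = p = q = 0\<close>. With \<open>y = j + 1/2\<close>, the quotient of Gamma values has
  become the reciprocal of the product of the \<open>4 N + 1\<close> half-integers \<open>y - N, \<dots>, y + 3 N\<close>.
\<close>

definition seed :: "nat \<Rightarrow> nat \<Rightarrow> real" where
  "seed N j = 2 * (fact (2 * N))\<^sup>2
     / ((half j + real N)\<^sup>2 * pochhammer (half j - real N) (4 * N + 1))"

text \<open>
  The quotients \<open>seed (N+1) j / seed N j\<close> and \<open>seed N (j+1) / seed N j\<close> as rational functions
  of \<open>n = N\<close> and \<open>y = j + 1/2\<close>.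
\<close>

definition ratioN :: "real \<Rightarrow> real \<Rightarrow> real" where
  "ratioN n y = ((2*n+1)*(2*n+2))^2 * (y+n)^2
     / ((y+n+1)^2 * (y-n-1) * (y+3*n+1) * (y+3*n+2) * (y+3*n+3))"

definition ratioJ :: "real \<Rightarrow> real \<Rightarrow> real" where
  "ratioJ n y = (y+n)^2 * (y-n) / ((y+n+1)^2 * (y+3*n+1))"

lemma half_Suc: "half (Suc j) = half j + 1"
  by (simp add: half_def)

lemma half_pos: "half j > 0"
  by (simp add: half_def)

lemma half_0: "half 0 = 1 / 2"
  by (simp add: half_def)

lemma half_minus_nat_abs_ge: "\<bar>half j - real m\<bar> \<ge> 1 / 2"
proof (cases "m \<le> j")
  case True
  then have "real m \<le> real j" by simp
  then show ?thesis by (simp add: half_def)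
next
  case False
  then have "real j + 1 \<le> real m" by linarith
  then show ?thesis by (simp add: half_def)
qed

lemma half_minus_nat_neq_0: "half j - real m \<noteq> 0"
  using half_minus_nat_abs_ge[of j m] by auto

lemma half_shift_abs_ge: "\<bar>half j - real N + real s\<bar> \<ge> 1 / 2"
proof -
  have "half (j + s) - real N = half j - real N + real s"
    by (simp add: half_def)
  then show ?thesis using half_minus_nat_abs_ge[of "j + s" N] by metis
qed

lemma pochhammer_half_neq_0: "pochhammer (half j - real N) m \<noteq> 0"
proof
  assume "pochhammer (half j - real N) m = 0"
  then obtain k where "half j - real N = - real k"
    by (auto simp: pochhammer_eq_0_iff)
  then show False using half_shift_abs_ge[of j N k] by simp
qed

lemma seed_factors_neq_0:
  "half j - real N - 1 \<noteq> 0" "half j - real N \<noteq> 0" "half j + real N \<noteq> 0"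
  "half j + real N + 1 \<noteq> 0" "half j + 3 * real N + 1 \<noteq> 0" "half j + 3 * real N + 2 \<noteq> 0"
  "half j + 3 * real N + 3 \<noteq> 0"
  using half_minus_nat_neq_0[of j "Suc N"] half_minus_nat_neq_0[of j N] half_pos[of j]
  by (auto simp: algebra_simps)

lemma pochhammer_half_Suc_N:
  "pochhammer (half j - real (Suc N)) (4 * Suc N + 1)
     = (half j - real N - 1) * pochhammer (half j - real N) (4 * N + 1)
       * (half j + 3 * real N + 1) * (half j + 3 * real N + 2) * (half j + 3 * real N + 3)"
proof -
  have "4 * Suc N + 1 = Suc (4 * N + 4)" by simp
  then have "pochhammer (half j - real (Suc N)) (4 * Suc N + 1)
      = (half j - real N - 1) * pochhammer (half j - real N) (4 * N + 4)"
    by (simp only: pochhammer_rec) (simp add: algebra_simps)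
  also have "4 * N + 4 = Suc (Suc (Suc (4 * N + 1)))" by simp
  finally show ?thesis by (simp add: pochhammer_Suc algebra_simps)
qed

lemma pochhammer_half_Suc_j:
  "(half j - real N) * pochhammer (half (Suc j) - real N) (4 * N + 1)
     = pochhammer (half j - real N) (4 * N + 1) * (half j + 3 * real N + 1)"
proof -
  have "(half j - real N) * pochhammer (half (Suc j) - real N) (4 * N + 1)
      = pochhammer (half j - real N) (Suc (4 * N + 1))"
    by (subst pochhammer_rec) (simp add: half_Suc algebra_simps)
  then show ?thesis by (simp only: pochhammer_Suc) (simp add: algebra_simps)
qed

lemma fact_double_Suc: "fact (2 * Suc N) = (2 * real N + 1) * (2 * real N + 2) * fact (2 * N)"
  by (simp add: algebra_simps)

lemma seed_Suc_N: "seed (Suc N) j = seed N j * ratioN (real N) (half j)"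
proof -
  have atoms: "2 * (a * b * f)\<^sup>2 / (y1\<^sup>2 * (x * p * z1 * z2 * z3))
      = 2 * f\<^sup>2 / (y0\<^sup>2 * p) * ((a * b)\<^sup>2 * y0\<^sup>2 / (y1\<^sup>2 * x * z1 * z2 * z3))"
    if "y0 \<noteq> 0" for a b f p x y0 y1 z1 z2 z3 :: real
    using that by (simp add: power_mult_distrib mult_ac)
  have "half j + real (Suc N) = half j + real N + 1" by simp
  then show ?thesis
    unfolding seed_def ratioN_def pochhammer_half_Suc_N fact_double_Suc
    by (simp only: atoms[OF seed_factors_neq_0(3)[of j N]])
qed

lemma seed_Suc_j: "seed N (Suc j) = seed N j * ratioJ (real N) (half j)"
proof -
  have *: "pochhammer (half (Suc j) - real N) (4 * N + 1)
     = pochhammer (half j - real N) (4 * N + 1) * (half j + 3 * real N + 1) / (half j - real N)"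
    using pochhammer_half_Suc_j[of j N] seed_factors_neq_0(2)[of j N] by (simp add: field_simps)
  have atoms: "2 * f / (y1\<^sup>2 * (p * z / x)) = 2 * f / (y0\<^sup>2 * p) * (y0\<^sup>2 * x / (y1\<^sup>2 * z))"
    if "y0 \<noteq> 0" for f p x y0 y1 z :: real
    using that by (simp add: mult_ac)
  have "half (Suc j) + real N = half j + real N + 1" by (simp add: half_Suc)
  then show ?thesis
    unfolding seed_def ratioJ_def * by (simp only: atoms[OF seed_factors_neq_0(3)[of j N]])
qed

section \<open>Rational certificates\<close>

text \<open>
  Numerators and denominators of the rational functions \<open>c\<close> (called \<open>cert\<close>) and \<open>g\<close>. The
  numerators are determined by the WZ relation: with the denominators prescribed it is a system of
  linear equations for the coefficients of a polynomial of bounded degree, and its solution is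
  unique.
\<close>

definition certden :: "real \<Rightarrow> real \<Rightarrow> real" where
  "certden n y = (y - n - 1) * (y + 3*n + 1) * (y + 3*n + 2)"

definition certnum :: "real \<Rightarrow> real \<Rightarrow> real" where
  "certnum n y = y^4 * (2 + 2*n) + y^3 * (6 + 22*n + 16*n^2) + y^2 * (3 + 28*n + 62*n^2 + 36*n^3)
     - y * (4 + 22*n + 34*n^2 + 14*n^3) - (8 + 68*n + 225*n^2 + 360*n^3 + 280*n^4 + 86*n^5)"

definition cert :: "real \<Rightarrow> real \<Rightarrow> real" where
  "cert n y = certnum n y / (2 * (certden n y * ((2*n+1)*(2*n+2))))"

definition numH1 :: "real \<Rightarrow> real \<Rightarrow> real" where
  "numH1 n y = y^3 * (12 + 48*n - 8*n^2 - 196*n^3 - 176*n^4)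
     + y^2 * (18*n + 74*n^2 - 1 - 242*n^4 - 214*n^5)
     - y^6 * (2 + 2*n) - y^5 * (8 + 30*n + 24*n^2) - y^4 * (3 + 48*n + 132*n^2 + 98*n^3)
     - y * (10 + 96*n + 364*n^2 + 752*n^3 + 976*n^4 + 798*n^5 + 312*n^6)
     - (10*n + 95*n^2 + 370*n^3 + 775*n^4 + 944*n^5 + 648*n^6 + 198*n^7)"

definition certH1 :: "real \<Rightarrow> real \<Rightarrow> real" where
  "certH1 n y = numH1 n y / (4 * ((certden n y)^2 * ((2*n+1)*(2*n+2))))"

definition numC :: "real \<Rightarrow> real \<Rightarrow> real" where
  "numC n y = y^3 * (20 + 104*n + 160*n^2 + 56*n^3 - 24*n^4)
     + y^2 * (7 + 90*n + 346*n^2 + 552*n^3 + 362*n^4 + 66*n^5)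
     - y^6 * (2 + 2*n) - y^5 * (8 + 28*n + 20*n^2) - y^4 * (3 + 40*n + 98*n^2 + 62*n^3)
     - y * (20 + 174*n + 608*n^2 + 1120*n^3 + 1192*n^4 + 732*n^5 + 212*n^6)
     - (20*n + 181*n^2 + 678*n^3 + 1359*n^4 + 1552*n^5 + 966*n^6 + 258*n^7)"

definition certC :: "real \<Rightarrow> real \<Rightarrow> real" where
  "certC n y = numC n y / (2 * ((certden n y)^2 * ((2*n+1)*(2*n+2))))"

definition numH2 :: "real \<Rightarrow> real \<Rightarrow> real" where
  "numH2 n y = y^2 + y * (2 + 4*n) - (5 + 20*n + 29*n^2 + 16*n^3)"

definition certH2 :: "real \<Rightarrow> real \<Rightarrow> real" where
  "certH2 n y = numH2 n y / (2 * (certden n y * ((2*n+1)*(2*n+2))))"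

definition numH3 :: "real \<Rightarrow> real \<Rightarrow> real" where
  "numH3 n y = y^3 + y^2 * (2 + 5*n) + y * (2 + 6*n + 7*n^2) - (5 + 20*n + 28*n^2 + 13*n^3)"

definition certH3 :: "real \<Rightarrow> real \<Rightarrow> real" where
  "certH3 n y = numH3 n y / (2 * (certden n y * ((2*n+1)*(2*n+2)) * (y + n)))"

lemma certden_Suc: "certden n (y + 1) = (y - n) * (y + 3*n + 2) * (y + 3*n + 3)"
  by (simp add: certden_def algebra_simps)

context
  fixes n y :: real
  assumes nz: "y - n - 1 \<noteq> 0" "y - n \<noteq> 0" "y + n \<noteq> 0" "y + n + 1 \<noteq> 0" "y + 3*n + 1 \<noteq> 0"
    "y + 3*n + 2 \<noteq> 0" "y + 3*n + 3 \<noteq> 0" "n \<ge> 0"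
begin

text \<open>
  The WZ relation for \<open>seed\<close>, divided by \<open>seed N j\<close>. Here and in the next four lemmas the linear
  factors are first replaced by independent variables, so that clearing denominators stays cheap;
  the polynomial identity that is left is then checked in \<open>n\<close> and \<open>y\<close>.
\<close>

lemma seed_wz_ratio:
  "ratioN n y - 1 = ratioJ n y * cert n (y + 1) - cert n y"
proof -
  have atoms: "q^2*y0^2 / (y1^2*x0*z1*z2*z3) - 1
      = (y0^2*x1 / (y1^2*z1)) * (h' / (2*(x1*z2*z3*q))) - h / (2*(x0*z1*z2*q))"
    if E: "2 * (q^3 * y0^2 - y1^2*x0*z1*z2*z3*q) = y0^2 * x0 * h' - y1^2*z3*h"
      and "x0 \<noteq> 0" "x1 \<noteq> 0" "y0 \<noteq> 0" "y1 \<noteq> 0" "z1 \<noteq> 0" "z2 \<noteq> 0" "z3 \<noteq> 0" "q \<noteq> 0"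
    for x0 x1 y0 y1 z1 z2 z3 q h h' :: real
  proof -
    have "q^2*y0^2 / (y1^2*x0*z1*z2*z3) - 1
        = 2 * (q^3 * y0^2 - y1^2*x0*z1*z2*z3*q) / (2 * (y1^2*x0*z1*z2*z3*q))"
      using that(2-) by (simp add: field_simps power2_eq_square power3_eq_cube)
    also have "\<dots> = (y0^2*x1 / (y1^2*z1)) * (h' / (2*(x1*z2*z3*q))) - h / (2*(x0*z1*z2*q))"
      unfolding E using that(2-) by (simp add: field_simps power2_eq_square)
    finally show ?thesis .
  qed
  have "2 * (((2*n+1)*(2*n+2))^3*(y+n)^2
        - (y+n+1)^2*(y-n-1)*(y+3*n+1)*(y+3*n+2)*(y+3*n+3)*((2*n+1)*(2*n+2)))
      = (y+n)^2 * (y-n-1) * certnum n (y+1) - (y+n+1)^2 * (y+3*n+3) * certnum n y"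
    unfolding certnum_def by algebra
  from atoms[OF this] show ?thesis
    unfolding ratioN_def ratioJ_def cert_def certden_Suc unfolding certden_def
    using nz by simp
qed

text \<open>
  For a weight \<open>L\<close> with rational increments \<open>dN\<close> and \<open>dJ\<close>, the terms of the differentiated WZ relation
  that contain \<open>L\<close> itself cancel by \<open>seed_wz_ratio\<close>. What is left, divided by \<open>seed N j\<close>, is an
  equation for \<open>g\<close>. This lemma and the next three solve it for the weights defined below.
\<close>

lemma weightH1_wz_ratio:
  "ratioN n y * (3/2/(y+n+1) - 3/2/(y+n) + 1/(2*n+1) + 1/(2*n+2) + 1/(y-n-1) + 1/(y+n))
   - ratioJ n y * cert n (y+1) * (3/2/(y+n+1) - 3/2/(y+n) + 1/(y+n) - 1/(y-n))
   = ratioJ n y * certH1 n (y+1) - certH1 n y"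
proof -
  have atoms: "q^2*y0^2 / (y1^2*x0*z1*z2*z3) * (3/2/y1 - 3/2/y0 + 1/a + 1/b + 1/x0 + 1/y0)
      - (y0^2*x1 / (y1^2*z1)) * (h' / (2*(x1*z2*z3*q))) * (3/2/y1 - 3/2/y0 + 1/y0 - 1/x1)
      = (y0^2*x1 / (y1^2*z1)) * (g' / (4*((x1*z2*z3)^2*q))) - g / (4*((x0*z1*z2)^2*q))"
    if E: "2*q^2*y0*x1*z1*z2*z3*(3*y0*x0*q - y1*x0*q + 2*y1*y0*x0*(a+b) + 2*y1*y0*q)
        - y0*h'*x0^2*z1*z2*z3*(3*y0*x1 - y1*x1 - 2*y1*y0)
        = y0^2*g'*y1*x0^2*z1 - y1^3*x1*z3^2*g"
      and nz: "x0 \<noteq> 0" "x1 \<noteq> 0" "y0 \<noteq> 0" "y1 \<noteq> 0" "z1 \<noteq> 0" "z2 \<noteq> 0" "z3 \<noteq> 0" "a \<noteq> 0" "b \<noteq> 0"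
      and q: "q = a * b"
    for x0 x1 y0 y1 z1 z2 z3 q h h' g g' a b :: real
  proof -
    define D where "D = 4*y1^3*x0^2*x1*z1^2*z2^2*z3^2*q"
    have dN: "3/2/y1 - 3/2/y0 + 1/a + 1/b + 1/x0 + 1/y0
        = (3*y0*x0*q - y1*x0*q + 2*y1*y0*x0*(a+b) + 2*y1*y0*q) / (2*y1*y0*x0*q)"
      using nz by (simp add: q field_simps)
    have dJ: "3/2/y1 - 3/2/y0 + 1/y0 - 1/x1 = (3*y0*x1 - y1*x1 - 2*y1*y0) / (2*y1*y0*x1)"
      using nz by (simp add: field_simps)
    have qnz: "q \<noteq> 0" using nz q by simp
    have t1: "q^2*y0^2 / (y1^2*x0*z1*z2*z3) * (P / (2*y1*y0*x0*q)) = 2*q^2*y0*x1*z1*z2*z3*P / D" for P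
      unfolding D_def using nz qnz by (simp add: field_simps eval_nat_numeral)
    have t2: "(y0^2*x1 / (y1^2*z1)) * (h' / (2*(x1*z2*z3*q))) * (P / (2*y1*y0*x1)) = y0*h'*x0^2*z1*z2*z3*P / D" for P
      unfolding D_def using nz qnz by (simp add: field_simps eval_nat_numeral)
    have t3: "(y0^2*x1 / (y1^2*z1)) * (g' / (4*((x1*z2*z3)^2*q))) = y0^2*g'*y1*x0^2*z1 / D"
      unfolding D_def using nz qnz by (simp add: field_simps eval_nat_numeral)
    have t4: "g / (4*((x0*z1*z2)^2*q)) = y1^3*x1*z3^2*g / D"
      unfolding D_def using nz qnz by (simp add: field_simps eval_nat_numeral)
    show ?thesis
      unfolding dN dJ t1 t2 t3 t4 using E by (simp only: diff_divide_distrib[symmetric])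
  qed
  have "2*((2*n+1)*(2*n+2))^2*(y+n)*(y-n)*(y+3*n+1)*(y+3*n+2)*(y+3*n+3)
        *(3*(y+n)*(y-n-1)*((2*n+1)*(2*n+2)) - (y+n+1)*(y-n-1)*((2*n+1)*(2*n+2))
          + 2*(y+n+1)*(y+n)*(y-n-1)*((2*n+1)+(2*n+2)) + 2*(y+n+1)*(y+n)*((2*n+1)*(2*n+2)))
      - (y+n)*certnum n (y+1)*(y-n-1)^2*(y+3*n+1)*(y+3*n+2)*(y+3*n+3)
        *(3*(y+n)*(y-n) - (y+n+1)*(y-n) - 2*(y+n+1)*(y+n))
      = (y+n)^2*numH1 n (y+1)*(y+n+1)*(y-n-1)^2*(y+3*n+1)
        - (y+n+1)^3*(y-n)*(y+3*n+3)^2*numH1 n y"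
    unfolding certnum_def numH1_def by algebra
  from atoms[OF this] show ?thesis
    unfolding ratioN_def ratioJ_def cert_def certH1_def certden_Suc unfolding certden_def
    using nz by simp
qed

lemma weightC_wz_ratio:
  "ratioN n y * (2/(y+n+1) - 2/(y+n) + 1/(y-n-1) + 1/(y+3*n+1) + 1/(y+3*n+2) + 1/(y+3*n+3))
   - ratioJ n y * cert n (y+1) * (2/(y+n+1) - 2/(y+n) + 1/(y+3*n+1) - 1/(y-n))
   = ratioJ n y * certC n (y+1) - certC n y"
proof -
  have atoms: "q^2*y0^2 / (y1^2*x0*z1*z2*z3) * (2/y1 - 2/y0 + 1/x0 + 1/z1 + 1/z2 + 1/z3)
      - (y0^2*x1 / (y1^2*z1)) * (h' / (2*(x1*z2*z3*q))) * (2/y1 - 2/y0 + 1/z1 - 1/x1)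
      = (y0^2*x1 / (y1^2*z1)) * (g' / (2*((x1*z2*z3)^2*q))) - g / (2*((x0*z1*z2)^2*q))"
    if E: "2*q^3*y0*x1*(2*(y0-y1)*x0*z1*z2*z3 + y1*y0*(z1*z2*z3 + x0*(z2*z3 + z1*z3 + z1*z2)))
        - y0*h'*x0^2*z2*z3*(2*(y0-y1)*z1*x1 + y1*y0*(x1-z1))
        = y0^2*g'*y1*x0^2*z1 - y1^3*x1*z3^2*g"
      and nz: "x0 \<noteq> 0" "x1 \<noteq> 0" "y0 \<noteq> 0" "y1 \<noteq> 0" "z1 \<noteq> 0" "z2 \<noteq> 0" "z3 \<noteq> 0" "q \<noteq> 0"
    for x0 x1 y0 y1 z1 z2 z3 q h h' g g' :: real
  proof -
    note qnz = nz(8)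
    define D where "D = 2*y1^3*x0^2*x1*z1^2*z2^2*z3^2*q"
    have dN: "2/y1 - 2/y0 + 1/x0 + 1/z1 + 1/z2 + 1/z3
        = (2*(y0-y1)*x0*z1*z2*z3 + y1*y0*(z1*z2*z3 + x0*(z2*z3 + z1*z3 + z1*z2))) / (y1*y0*x0*z1*z2*z3)"
      using nz by (simp add: field_simps)
    have dJ: "2/y1 - 2/y0 + 1/z1 - 1/x1 = (2*(y0-y1)*z1*x1 + y1*y0*(x1-z1)) / (y1*y0*z1*x1)"
      using nz by (simp add: field_simps)
    have t1: "q^2*y0^2 / (y1^2*x0*z1*z2*z3) * (P / (y1*y0*x0*z1*z2*z3)) = 2*q^3*y0*x1*P / D" for P
      unfolding D_def using nz qnz by (simp add: field_simps eval_nat_numeral)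
    have t2: "(y0^2*x1 / (y1^2*z1)) * (h' / (2*(x1*z2*z3*q))) * (P / (y1*y0*z1*x1)) = y0*h'*x0^2*z2*z3*P / D" for P
      unfolding D_def using nz qnz by (simp add: field_simps eval_nat_numeral)
    have t3: "(y0^2*x1 / (y1^2*z1)) * (g' / (2*((x1*z2*z3)^2*q))) = y0^2*g'*y1*x0^2*z1 / D"
      unfolding D_def using nz qnz by (simp add: field_simps eval_nat_numeral)
    have t4: "g / (2*((x0*z1*z2)^2*q)) = y1^3*x1*z3^2*g / D"
      unfolding D_def using nz qnz by (simp add: field_simps eval_nat_numeral)
    show ?thesis
      unfolding dN dJ t1 t2 t3 t4 using E by (simp only: diff_divide_distrib[symmetric])
  qed
  have "2*((2*n+1)*(2*n+2))^3*(y+n)*(y-n)*(2*((y+n)-(y+n+1))*(y-n-1)*(y+3*n+1)*(y+3*n+2)*(y+3*n+3)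
        + (y+n+1)*(y+n)*((y+3*n+1)*(y+3*n+2)*(y+3*n+3) + (y-n-1)*((y+3*n+2)*(y+3*n+3)
            + (y+3*n+1)*(y+3*n+3) + (y+3*n+1)*(y+3*n+2))))
      - (y+n)*certnum n (y+1)*(y-n-1)^2*(y+3*n+2)*(y+3*n+3)
        *(2*((y+n)-(y+n+1))*(y+3*n+1)*(y-n) + (y+n+1)*(y+n)*((y-n)-(y+3*n+1)))
      = (y+n)^2*numC n (y+1)*(y+n+1)*(y-n-1)^2*(y+3*n+1)
        - (y+n+1)^3*(y-n)*(y+3*n+3)^2*numC n y"
    unfolding certnum_def numC_def by algebra
  from atoms[OF this] show ?thesis
    unfolding ratioN_def ratioJ_def cert_def certC_def certden_Suc unfolding certden_def
    using nz by simp
qed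

lemma weightH2_wz_ratio:
  "ratioN n y * (1/(2*n+1)^2 + 1/(2*n+2)^2 + 1/(y+n)^2 - 1/(y+n+1)^2)
   - ratioJ n y * cert n (y+1) * (1/(y+n)^2 - 1/(y+n+1)^2)
   = ratioJ n y * certH2 n (y+1) - certH2 n y"
proof -
  have atoms: "q^2*y0^2 / (y1^2*x0*z1*z2*z3) * (1/a^2 + 1/b^2 + 1/y0^2 - 1/y1^2)
      - (y0^2*x1 / (y1^2*z1)) * (h' / (2*(x1*z2*z3*q))) * (1/y0^2 - 1/y1^2)
      = (y0^2*x1 / (y1^2*z1)) * (g' / (2*(x1*z2*z3*q))) - g / (2*(x0*z1*z2*q))"
    if E: "2*q*(y1^2*y0^2*(a^2+b^2) + q^2*(y1^2-y0^2)) - h'*x0*(y1^2-y0^2)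
        = y0^2*y1^2*x0*g' - y1^4*z3*g"
      and nz: "x0 \<noteq> 0" "x1 \<noteq> 0" "y0 \<noteq> 0" "y1 \<noteq> 0" "z1 \<noteq> 0" "z2 \<noteq> 0" "z3 \<noteq> 0" "a \<noteq> 0" "b \<noteq> 0"
      and q: "q = a * b"
    for x0 x1 y0 y1 z1 z2 z3 q h h' g g' a b :: real
  proof -
    define D where "D = 2*y1^4*x0*z1*z2*z3*q"
    have qnz: "q \<noteq> 0" using nz q by simp
    have dN: "1/a^2 + 1/b^2 + 1/y0^2 - 1/y1^2
        = (y1^2*y0^2*(a^2+b^2) + q^2*(y1^2-y0^2)) / (y1^2*y0^2*q^2)"
      using nz by (simp add: q field_simps)
    have dJ: "1/y0^2 - 1/y1^2 = (y1^2-y0^2) / (y1^2*y0^2)"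
      using nz by (simp add: field_simps)
    have t1: "q^2*y0^2 / (y1^2*x0*z1*z2*z3) * (P / (y1^2*y0^2*q^2)) = 2*q*P / D" for P
      unfolding D_def using nz qnz by (simp add: field_simps eval_nat_numeral)
    have t2: "(y0^2*x1 / (y1^2*z1)) * (h' / (2*(x1*z2*z3*q))) * (P / (y1^2*y0^2)) = h'*x0*P / D" for P
      unfolding D_def using nz qnz by (simp add: field_simps eval_nat_numeral)
    have t3: "(y0^2*x1 / (y1^2*z1)) * (g' / (2*(x1*z2*z3*q))) = y0^2*y1^2*x0*g' / D"
      unfolding D_def using nz qnz by (simp add: field_simps eval_nat_numeral)
    have t4: "g / (2*(x0*z1*z2*q)) = y1^4*z3*g / D"
      unfolding D_def using nz qnz by (simp add: field_simps eval_nat_numeral)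
    show ?thesis
      unfolding dN dJ t1 t2 t3 t4 using E by (simp only: diff_divide_distrib[symmetric])
  qed
  have "2*((2*n+1)*(2*n+2))*((y+n+1)^2*(y+n)^2*((2*n+1)^2+(2*n+2)^2)
          + ((2*n+1)*(2*n+2))^2*((y+n+1)^2-(y+n)^2))
        - certnum n (y+1)*(y-n-1)*((y+n+1)^2-(y+n)^2)
      = (y+n)^2*(y+n+1)^2*(y-n-1)*numH2 n (y+1) - (y+n+1)^4*(y+3*n+3)*numH2 n y"
    unfolding certnum_def numH2_def by algebra
  from atoms[OF this] show ?thesis
    unfolding ratioN_def ratioJ_def cert_def certH2_def certden_Suc unfolding certden_def
    using nz by simp
qed

lemma weightH3_wz_ratio:
  "ratioN n y * (1/(y+n)^3 + 1/(y+n+1)^3 - 1/(2*n+1)^3 - 1/(2*n+2)^3)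
   - ratioJ n y * cert n (y+1) * (1/(y+n)^3 + 1/(y+n+1)^3)
   = ratioJ n y * certH3 n (y+1) - certH3 n y"
proof -
  have atoms: "q^2*y0^2 / (y1^2*x0*z1*z2*z3) * (1/y0^3 + 1/y1^3 - 1/a^3 - 1/b^3)
      - (y0^2*x1 / (y1^2*z1)) * (h' / (2*(x1*z2*z3*q))) * (1/y0^3 + 1/y1^3)
      = (y0^2*x1 / (y1^2*z1)) * (g' / (2*(x1*z2*z3*q*y1))) - g / (2*(x0*z1*z2*q*y0))"
    if E: "2*(q^3*(y0^3+y1^3) - y1^3*y0^3*(a^3+b^3)) - h'*x0*(y0^3+y1^3)
        = y0^3*y1^2*x0*g' - y1^5*z3*g"
      and nz: "x0 \<noteq> 0" "x1 \<noteq> 0" "y0 \<noteq> 0" "y1 \<noteq> 0" "z1 \<noteq> 0" "z2 \<noteq> 0" "z3 \<noteq> 0" "a \<noteq> 0" "b \<noteq> 0"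
      and q: "q = a * b"
    for x0 x1 y0 y1 z1 z2 z3 q h h' g g' a b :: real
  proof -
    define D where "D = 2*y1^5*y0*x0*z1*z2*z3*q"
    have qnz: "q \<noteq> 0" using nz q by simp
    have dN: "1/y0^3 + 1/y1^3 - 1/a^3 - 1/b^3
        = (q^3*(y0^3+y1^3) - y1^3*y0^3*(a^3+b^3)) / (y1^3*y0^3*q^3)"
      using nz by (simp add: q power_mult_distrib) (simp add: field_simps)
    have dJ: "1/y0^3 + 1/y1^3 = (y0^3+y1^3) / (y1^3*y0^3)"
      using nz by (simp add: field_simps)
    have t1: "q^2*y0^2 / (y1^2*x0*z1*z2*z3) * (P / (y1^3*y0^3*q^3)) = 2*P / D" for P
      unfolding D_def using nz qnz by (simp add: field_simps eval_nat_numeral)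
    have t2: "(y0^2*x1 / (y1^2*z1)) * (h' / (2*(x1*z2*z3*q))) * (P / (y1^3*y0^3)) = h'*x0*P / D" for P
      unfolding D_def using nz qnz by (simp add: field_simps eval_nat_numeral)
    have t3: "(y0^2*x1 / (y1^2*z1)) * (g' / (2*(x1*z2*z3*q*y1))) = y0^3*y1^2*x0*g' / D"
      unfolding D_def using nz qnz by (simp add: field_simps eval_nat_numeral)
    have t4: "g / (2*(x0*z1*z2*q*y0)) = y1^5*z3*g / D"
      unfolding D_def using nz qnz by (simp add: field_simps eval_nat_numeral)
    show ?thesis
      unfolding dN unfolding dJ t1 t2 t3 t4 using E by (simp only: diff_divide_distrib[symmetric])
  qed
  have "2*(((2*n+1)*(2*n+2))^3*((y+n)^3+(y+n+1)^3) - (y+n+1)^3*(y+n)^3*((2*n+1)^3+(2*n+2)^3))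
        - certnum n (y+1)*(y-n-1)*((y+n)^3+(y+n+1)^3)
      = (y+n)^3*(y+n+1)^2*(y-n-1)*numH3 n (y+1) - (y+n+1)^5*(y+3*n+3)*numH3 n y"
    unfolding certnum_def numH3_def by algebra
  from atoms[OF this] show ?thesis
    unfolding ratioN_def ratioJ_def cert_def certH3_def certden_Suc unfolding certden_def
    using nz by (simp add: add_ac)
qed

end

section \<open>Harmonic weights\<close>

text \<open>
  The logarithmic derivatives of the parametric \<open>F\<close> at the origin in the directions
  \<open>- \<partial>\<^sub>\<alpha> - \<partial>\<^sub>\<sigma>\<close>, \<open>- \<partial>\<^sub>\<alpha>\<close>, \<open>\<partial>\<^sub>p\<close> and \<open>\<partial>\<^sub>q\<close>, in this order.
\<close>

definition weightH1 :: "nat \<Rightarrow> nat \<Rightarrow> real" where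
  "weightH1 N j = H 1 (2 * N) + 3 / 2 / (half j + real N)
     + (\<Sum>s<2 * N. 1 / (half j - real N + real s))"

definition weightC :: "nat \<Rightarrow> nat \<Rightarrow> real" where
  "weightC N j = 2 / (half j + real N) + (\<Sum>s<4 * N + 1. 1 / (half j - real N + real s))"

definition weightH2 :: "nat \<Rightarrow> nat \<Rightarrow> real" where
  "weightH2 N j = H 2 (2 * N) - 1 / (half j + real N)\<^sup>2"

definition weightH3 :: "nat \<Rightarrow> nat \<Rightarrow> real" where
  "weightH3 N j = 2 * (\<Sum>i<N + j. 1 / half i ^ 3) + 1 / (half j + real N) ^ 3 - H 3 (2 * N)"

lemma H_0: "H m 0 = 0"
  by (simp add: H_def)

lemma H_Suc: "H m (Suc n) = H m n + 1 / real (Suc n) ^ m"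
proof -
  have "{0<..Suc n} = insert (Suc n) {0<..n}" by auto
  then show ?thesis by (simp add: H_def)
qed

lemma H_double_Suc:
  "H m (2 * Suc N) = H m (2 * N) + 1 / (2 * real N + 1) ^ m + 1 / (2 * real N + 2) ^ m"
proof -
  have "2 * Suc N = Suc (Suc (2 * N))" by simp
  then show ?thesis by (simp only: H_Suc) (simp add: add_ac)
qed

lemma H_bound: "0 \<le> H m n" "H m n \<le> real n"
proof -
  show "0 \<le> H m n" unfolding H_def by (intro sum_nonneg) auto
  have "H m n \<le> (\<Sum>j\<in>{0<..n}. 1)"
    unfolding H_def by (intro sum_mono) (auto simp: divide_le_eq_1)
  then show "H m n \<le> real n" by simp
qed

lemma sum_shift_Suc:
  fixes f :: "real \<Rightarrow> real"
  shows "(\<Sum>s<m. f (a + 1 + real s)) = (\<Sum>s<m. f (a + real s)) + f (a + real m) - f a"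
proof -
  have "(\<Sum>s<m. f (a + 1 + real s)) - (\<Sum>s<m. f (a + real s))
      = (\<Sum>s<m. f (a + real (Suc s)) - f (a + real s))"
    by (simp add: sum_subtractf add_ac)
  also have "\<dots> = f (a + real m) - f (a + real 0)"
    by (rule sum_lessThan_telescope)
  finally show ?thesis by simp
qed

lemma sum_extend_left:
  fixes f :: "real \<Rightarrow> real"
  shows "(\<Sum>s<Suc m. f (a - 1 + real s)) = f (a - 1) + (\<Sum>s<m. f (a + real s))"
  by (subst sum.lessThan_Suc_shift) (simp add: algebra_simps)

lemma weightH1_Suc_N:
  "weightH1 (Suc N) j = weightH1 N j + (3/2/(half j+real N+1) - 3/2/(half j+real N)
     + 1/(2*real N+1) + 1/(2*real N+2) + 1/(half j-real N-1) + 1/(half j+real N))"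
proof -
  have "(\<Sum>s<2 * Suc N. 1 / (half j - real (Suc N) + real s))
      = (\<Sum>s<Suc (Suc (2 * N)). 1 / (half j - real N - 1 + real s))"
    by (intro sum.cong) (auto simp: algebra_simps)
  also have "\<dots> = 1/(half j-real N-1) + (\<Sum>s<Suc (2 * N). 1 / (half j - real N + real s))"
    by (rule sum_extend_left)
  also have "\<dots> = 1/(half j-real N-1) + (\<Sum>s<2 * N. 1 / (half j - real N + real s)) + 1/(half j+real N)"
    by simp
  finally show ?thesis
    unfolding weightH1_def H_double_Suc by (simp add: add_ac)
qed

lemma weightH1_Suc_j:
  "weightH1 N (Suc j) = weightH1 N j + (3/2/(half j+real N+1) - 3/2/(half j+real N)
     + 1/(half j+real N) - 1/(half j-real N))"
  using sum_shift_Suc[where f="\<lambda>t. 1 / t" and a="half j - real N" and m="2 * N"]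
  by (simp add: weightH1_def half_Suc algebra_simps)

lemma weightC_Suc_N:
  "weightC (Suc N) j = weightC N j + (2/(half j+real N+1) - 2/(half j+real N)
     + 1/(half j-real N-1) + 1/(half j+3*real N+1) + 1/(half j+3*real N+2) + 1/(half j+3*real N+3))"
proof -
  have "(\<Sum>s<4 * Suc N + 1. 1 / (half j - real (Suc N) + real s))
      = (\<Sum>s<Suc (4 * N + 4). 1 / (half j - real N - 1 + real s))"
    by (intro sum.cong) (auto simp: algebra_simps)
  also have "\<dots> = 1/(half j-real N-1) + (\<Sum>s<4 * N + 4. 1 / (half j - real N + real s))"
    by (rule sum_extend_left)
  also have "4 * N + 4 = Suc (Suc (Suc (4 * N + 1)))" by simp
  finally show ?thesis
    unfolding weightC_def by (simp add: algebra_simps)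
qed

lemma weightC_Suc_j:
  "weightC N (Suc j) = weightC N j + (2/(half j+real N+1) - 2/(half j+real N)
     + 1/(half j+3*real N+1) - 1/(half j-real N))"
  using sum_shift_Suc[where f="\<lambda>t. 1 / t" and a="half j - real N" and m="4 * N + 1"]
  by (simp add: weightC_def half_Suc algebra_simps)

lemma weightH2_Suc_N:
  "weightH2 (Suc N) j = weightH2 N j + (1/(2*real N+1)^2 + 1/(2*real N+2)^2
     + 1/(half j+real N)^2 - 1/(half j+real N+1)^2)"
  unfolding weightH2_def H_double_Suc by (simp add: add_ac)

lemma weightH2_Suc_j:
  "weightH2 N (Suc j) = weightH2 N j + (1/(half j+real N)^2 - 1/(half j+real N+1)^2)"
  unfolding weightH2_def by (simp add: half_Suc add_ac)

lemma half_add: "half (N + j) = half j + real N"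
  by (simp add: half_def)

lemma weightH3_Suc_N:
  "weightH3 (Suc N) j = weightH3 N j + (1/(half j+real N)^3 + 1/(half j+real N+1)^3
     - 1/(2*real N+1)^3 - 1/(2*real N+2)^3)"
  unfolding weightH3_def H_double_Suc by (simp add: half_add add_ac)

lemma weightH3_Suc_j:
  "weightH3 N (Suc j) = weightH3 N j + (1/(half j+real N)^3 + 1/(half j+real N+1)^3)"
  unfolding weightH3_def by (simp add: half_add half_Suc add_ac)

text \<open>
  The product rule for differences: the weighted function satisfies a WZ relation as soon as \<open>g\<close>
  absorbs the contribution of the increments of the weight.
\<close>

lemma weighted_wz:
  fixes L :: "nat \<Rightarrow> nat \<Rightarrow> real" and g dN dJ :: "real \<Rightarrow> real \<Rightarrow> real"
  assumes LN: "L (Suc N) j = L N j + dN (real N) (half j)"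
    and LJ: "L N (Suc j) = L N j + dJ (real N) (half j)"
    and cert: "ratioN (real N) (half j) * dN (real N) (half j)
        - ratioJ (real N) (half j) * cert (real N) (half j + 1) * dJ (real N) (half j)
      = ratioJ (real N) (half j) * g (real N) (half j + 1) - g (real N) (half j)"
  shows "seed (Suc N) j * L (Suc N) j - seed N j * L N j
    = seed N (Suc j) * (cert (real N) (half (Suc j)) * L N (Suc j) + g (real N) (half (Suc j)))
      - seed N j * (cert (real N) (half j) * L N j + g (real N) (half j))"
proof -
  have *: "ratioN (real N) (half j) - 1
      = ratioJ (real N) (half j) * cert (real N) (half j + 1) - cert (real N) (half j)"
    using seed_factors_neq_0[of j N] by (intro seed_wz_ratio) auto
  show ?thesis
    unfolding seed_Suc_N seed_Suc_j LN LJ half_Suc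
    using * cert by algebra
qed

section \<open>Size of the seed\<close>

text \<open>
  The hypergeometric part of \<open>\<bar>seed\<bar>\<close>, without the factor \<open>2 / (y + N)\<^sup>2\<close>. It decreases in \<open>j\<close> on
  every row even though the product in its denominator changes sign, since
  \<open>\<bar>y - N\<bar> < y + 3 N + 1\<close>.
\<close>

definition seed_size :: "nat \<Rightarrow> nat \<Rightarrow> real" where
  "seed_size N j = (fact (2 * N))\<^sup>2 / \<bar>pochhammer (half j - real N) (4 * N + 1)\<bar>"

lemma seed_size_nonneg: "seed_size N j \<ge> 0"
  by (simp add: seed_size_def)

lemma abs_seed: "\<bar>seed N j\<bar> = 2 * seed_size N j / (half j + real N)\<^sup>2"
  by (simp add: seed_def seed_size_def abs_mult)

lemma seed_size_Suc_j:
  "seed_size N (Suc j) = seed_size N j * (\<bar>half j - real N\<bar> / (half j + 3 * real N + 1))"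
proof -
  have "\<bar>half j - real N\<bar> * \<bar>pochhammer (half (Suc j) - real N) (4 * N + 1)\<bar>
     = \<bar>pochhammer (half j - real N) (4 * N + 1)\<bar> * (half j + 3 * real N + 1)"
    using pochhammer_half_Suc_j[of j N] half_pos[of j]
    by (metis (no_types, opaque_lifting) abs_mult abs_of_pos add_pos_nonneg of_nat_0_le_iff
        mult_nonneg_nonneg zero_le_numeral zero_less_one add_nonneg_pos add_nonneg_nonneg less_imp_le)
  then have "\<bar>pochhammer (half (Suc j) - real N) (4 * N + 1)\<bar>
     = \<bar>pochhammer (half j - real N) (4 * N + 1)\<bar> * (half j + 3 * real N + 1) / \<bar>half j - real N\<bar>"
    using seed_factors_neq_0(2)[of j N] by (simp add: field_simps)
  then show ?thesis
    unfolding seed_size_def by simp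
qed

text \<open>
  The weak bound, valid also for \<open>N = 0\<close>, suffices for the limit along a row. The summable majorant
  comes from the stronger bound in the following lemma, which needs \<open>N \<ge> 1\<close>: for \<open>N = 0\<close> the
  size is \<open>1 / y\<close>.
\<close>

lemma seed_size_le: "seed_size N j \<le> seed_size N 0 / (real j + 1)"
proof (induction j)
  case (Suc j)
  have "\<bar>half j - real N\<bar> * (real j + 2) \<le> (half j + real N) * (real j + 2)"
    using half_pos[of j] by (intro mult_right_mono) auto
  also have "\<dots> \<le> (real j + 1) * (half j + 3 * real N + 1)"
  proof -
    have "0 \<le> real N * real j" by simp
    then show ?thesis by (simp add: half_def field_simps)
  qed
  finally have "\<bar>half j - real N\<bar> / (half j + 3 * real N + 1) \<le> (real j + 1) / (real j + 2)"
    using half_pos[of j] by (simp add: divide_simps)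
  then have "seed_size N (Suc j) \<le> seed_size N 0 / (real j + 1) * ((real j + 1) / (real j + 2))"
    unfolding seed_size_Suc_j using Suc.IH
    by (intro mult_mono) (auto simp: seed_size_nonneg half_def)
  then show ?case by (simp add: add_ac)
qed simp

lemma seed_size_le_quadratic:
  assumes N: "N \<ge> 1"
  shows "seed_size N j \<le> 2 * seed_size N 0 / ((real j + 1) * (real j + 2))"
proof (induction j)
  case (Suc j)
  have "\<bar>half j - real N\<bar> * (real j + 3) \<le> (real j + 1) * (half j + 3 * real N + 1)"
  proof (cases "half j \<ge> real N")
    case True
    have "(half j - real N) * (real j + 3) \<le> (half j - 1) * (real j + 3)"
      using N by (intro mult_right_mono) auto
    also have "\<dots> \<le> (real j + 1) * (half j + 3 * 1 + 1)"
      by (simp add: half_def field_simps)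
    also have "\<dots> \<le> (real j + 1) * (half j + 3 * real N + 1)"
      using N by (intro mult_left_mono) auto
    finally show ?thesis using True by simp
  next
    case False
    have "(real N - half j) * (real j + 3) \<le> real N * (3 * (real j + 1))"
      using False by (intro mult_mono) (auto simp: half_def)
    also have "\<dots> \<le> (real j + 1) * (half j + 3 * real N + 1)"
      using half_pos[of j] by (simp add: algebra_simps)
    finally show ?thesis using False by simp
  qed
  then have "\<bar>half j - real N\<bar> / (half j + 3 * real N + 1) \<le> (real j + 1) / (real j + 3)"
    using half_pos[of j] by (simp add: divide_simps)
  then have "seed_size N (Suc j) \<le> 2 * seed_size N 0 / ((real j + 1) * (real j + 2))
      * ((real j + 1) / (real j + 3))"
    unfolding seed_size_Suc_j using Suc.IH half_pos[of j]
    by (intro mult_mono) (auto simp: seed_size_nonneg)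
  also have "\<dots> = 2 * seed_size N 0 / ((real (Suc j) + 1) * (real (Suc j) + 2))"
    by (simp add: divide_simps) (simp add: algebra_simps)
  finally show ?case .
qed simp

text \<open>
  The quotient of consecutive sizes is \<open>16/27 \<cdot> (N+1)\<^sup>2 / ((N+1)\<^sup>2 - 1/36)\<close>; any constant
  between its maximum \<open>64/105\<close> and \<open>1\<close> would do.
\<close>

lemma seed_size_Suc_N: "seed_size (Suc N) 0 \<le> 3 / 4 * seed_size N 0"
proof -
  have p: "\<bar>pochhammer (half 0 - real (Suc N)) (4 * Suc N + 1)\<bar>
     = (real N + 1/2) * \<bar>pochhammer (half 0 - real N) (4 * N + 1)\<bar>
       * (3 * real N + 3/2) * (3 * real N + 5/2) * (3 * real N + 7/2)"
    unfolding pochhammer_half_Suc_N unfolding abs_mult half_0 by (simp add: add_ac)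
  have "((2 * real N + 1) * (2 * real N + 2))\<^sup>2 = 16 * ((real N + 1/2)\<^sup>2 * (real N + 1)\<^sup>2)"
    by (simp add: power2_eq_square field_simps)
  also have "\<dots> \<le> 9 / 4 * (real N + 1/2)\<^sup>2 * (8 * (real N + 1)\<^sup>2)"
    by simp
  also have "\<dots> \<le> 9 / 4 * (real N + 1/2)\<^sup>2 * ((3 * real N + 5/2) * (3 * real N + 7/2))"
    by (intro mult_left_mono) (auto simp: power2_eq_square field_simps)
  also have "\<dots> = 3 / 4 * ((real N + 1/2) * (3 * real N + 3/2) * (3 * real N + 5/2) * (3 * real N + 7/2))"
    by (simp add: power2_eq_square field_simps)
  finally have "((2 * real N + 1) * (2 * real N + 2))\<^sup>2
      \<le> 3 / 4 * ((real N + 1/2) * (3 * real N + 3/2) * (3 * real N + 5/2) * (3 * real N + 7/2))" .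
  then have "((2 * real N + 1) * (2 * real N + 2))\<^sup>2
        / ((real N + 1/2) * (3 * real N + 3/2) * (3 * real N + 5/2) * (3 * real N + 7/2)) \<le> 3 / 4"
    by (subst divide_le_eq) (auto intro!: mult_pos_pos)
  then have "((2 * real N + 1) * (2 * real N + 2))\<^sup>2
        / ((real N + 1/2) * (3 * real N + 3/2) * (3 * real N + 5/2) * (3 * real N + 7/2))
        * seed_size N 0 \<le> 3 / 4 * seed_size N 0"
    by (intro mult_right_mono seed_size_nonneg)
  also have "((2 * real N + 1) * (2 * real N + 2))\<^sup>2
        / ((real N + 1/2) * (3 * real N + 3/2) * (3 * real N + 5/2) * (3 * real N + 7/2))
        * seed_size N 0 = seed_size (Suc N) 0"
    unfolding seed_size_def p fact_double_Suc by (simp add: power_mult_distrib mult_ac)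
  finally show ?thesis .
qed

lemma seed_size_tendsto_0: "(\<lambda>N. seed_size N 0) \<longlonglongrightarrow> 0"
proof (rule tendsto_sandwich[of "\<lambda>_. 0" _ _ "\<lambda>N. seed_size 0 0 * (3 / 4) ^ N"])
  have "seed_size N 0 \<le> seed_size 0 0 * (3 / 4) ^ N" for N
  proof (induction N)
    case (Suc N)
    then show ?case using seed_size_Suc_N[of N] by simp
  qed simp
  then show "\<forall>\<^sub>F N in sequentially. seed_size N 0 \<le> seed_size 0 0 * (3 / 4) ^ N" by simp
  show "(\<lambda>N. seed_size 0 0 * (3 / 4) ^ N) \<longlonglongrightarrow> 0"
    by (intro tendsto_mult_right_zero LIMSEQ_realpow_zero) auto
qed (auto simp: seed_size_nonneg)

section \<open>Summation of the weighted pairs\<close>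

text \<open>
  A weight of at most linear growth cannot spoil convergence: \<open>1 / (y + N)\<^sup>2\<close>, which \<open>seed_size\<close>
  leaves out, absorbs it, and \<open>seed_size\<close> itself is summable along each row with \<open>N \<ge> 1\<close> and exponentially
  small in \<open>N\<close>.
\<close>

lemma weighted_sums:
  fixes L :: "nat \<Rightarrow> nat \<Rightarrow> real" and g dN dJ :: "real \<Rightarrow> real \<Rightarrow> real"
  assumes LN: "\<And>N j. L (Suc N) j = L N j + dN (real N) (half j)"
    and LJ: "\<And>N j. L N (Suc j) = L N j + dJ (real N) (half j)"
    and cert: "\<And>n y. y - n - 1 \<noteq> 0 \<Longrightarrow> y - n \<noteq> 0 \<Longrightarrow> y + n \<noteq> 0 \<Longrightarrow> y + n + 1 \<noteq> 0
      \<Longrightarrow> y + 3*n + 1 \<noteq> 0 \<Longrightarrow> y + 3*n + 2 \<noteq> 0 \<Longrightarrow> y + 3*n + 3 \<noteq> 0 \<Longrightarrow> n \<ge> 0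
      \<Longrightarrow> ratioN n y * dN n y - ratioJ n y * cert n (y + 1) * dJ n y = ratioJ n y * g n (y + 1) - g n y"
    and bound: "\<And>N j. \<bar>L N j\<bar> \<le> K * (real N + real j + 1)"
    and g: "\<And>n. ((\<lambda>y. g n y / y\<^sup>2) \<longlongrightarrow> 0) at_top"
    and c: "\<And>n. ((\<lambda>y. cert n y / y\<^sup>2) \<longlongrightarrow> 0) at_top"
    and S: "(\<lambda>j. 2 * L 0 j / half j ^ 3) sums S"
  shows "(\<lambda>N. seed N 0 * (cert (real N) (1/2) * L N 0 + g (real N) (1/2))) sums S"
proof -
  define G where "G = (\<lambda>N j. seed N j * (cert (real N) (half j) * L N j + g (real N) (half j)))"
  have K: "K \<ge> 0" using bound[of 0 0] by simp
  have "(\<lambda>N. G N 0) sums S"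
  proof (rule wz_sums)
    show "seed (Suc N) j * L (Suc N) j - seed N j * L N j = G N (Suc j) - G N j" for N j
      unfolding G_def using seed_factors_neq_0[of j N]
      by (intro weighted_wz[of L _ _ dN dJ g] LN LJ cert) auto
    show "\<bar>seed N j * L N j\<bar> \<le> 16 * K * seed_size N 0 / ((real j + 1) * (real j + 2))"
      if N: "N \<ge> 1" for N j
    proof -
      \<comment> \<open>With \<open>t = N + j\<close> this is \<open>t + 1 \<le> (2 t + 1)\<^sup>2\<close>.\<close>
      have "real N + real j + 1 \<le> 4 * (half j + real N)\<^sup>2"
        by (simp add: half_def power2_eq_square algebra_simps)
      then have *: "K * (real N + real j + 1) / (half j + real N)\<^sup>2 \<le> 4 * K"
        using K half_pos[of j] mult_left_mono[of "real N + real j + 1" "4 * (half j + real N)\<^sup>2" K]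
        by (simp add: divide_le_eq mult_ac)
      have "\<bar>seed N j * L N j\<bar> \<le> 2 * seed_size N j / (half j + real N)\<^sup>2 * (K * (real N + real j + 1))"
        unfolding abs_mult abs_seed by (intro mult_left_mono bound) (simp add: seed_size_nonneg)
      also have "\<dots> = 2 * seed_size N j * (K * (real N + real j + 1) / (half j + real N)\<^sup>2)"
        by simp
      also have "\<dots> \<le> 2 * (2 * seed_size N 0 / ((real j + 1) * (real j + 2))) * (4 * K)"
        using K seed_size_le_quadratic[OF N, of j]
        by (intro mult_mono *) (auto simp: seed_size_nonneg)
      finally show ?thesis by (simp add: mult_ac)
    qed
    show "(\<lambda>N. 16 * K * seed_size N 0) \<longlonglongrightarrow> 0"
      by (intro tendsto_mult_right_zero seed_size_tendsto_0)
    show "(\<lambda>j. seed 0 j * L 0 j) sums S"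
      using S by (simp add: seed_def power2_eq_square power3_eq_cube mult_ac)
    show "(\<lambda>j. G N j) \<longlonglongrightarrow> 0" for N
    proof -
      have h: "filterlim half at_top sequentially"
        by (rule filterlim_at_top_mono[OF filterlim_real_sequentially]) (simp add: half_def)
      define B where "B = 2 * seed_size N 0"
      define C where "C = 2 * K * (real N + 1)"
      have BC: "B \<ge> 0" "C \<ge> 0" using K by (auto simp: B_def C_def seed_size_nonneg)
      define E where "E = (\<lambda>j. B * (C * \<bar>cert (real N) (half j) / (half j)\<^sup>2\<bar>
        + 2 * \<bar>g (real N) (half j) / (half j)\<^sup>2\<bar>))"
      have E_lim: "E \<longlonglongrightarrow> B * (C * \<bar>0\<bar> + 2 * \<bar>0\<bar>)"
        unfolding E_def by (intro tendsto_intros filterlim_compose[OF g h] filterlim_compose[OF c h])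
      have G_le: "norm (G N j) \<le> E j" for j
      proof -
        let ?y = "half j"
        have y: "?y > 0" "?y \<le> real j + 1" "1 \<le> 2 * ?y" by (auto simp: half_def)
        have "\<bar>seed N j\<bar> \<le> B / (real j + 1) / (?y + real N)\<^sup>2"
          unfolding abs_seed B_def using seed_size_le[of N j] by (intro divide_right_mono) auto
        also have "\<dots> \<le> B / ?y / ?y\<^sup>2"
          using y BC by (intro frac_le divide_nonneg_nonneg power_mono) auto
        finally have s: "\<bar>seed N j\<bar> \<le> B / ?y / ?y\<^sup>2" .
        have "real N + real j + 1 \<le> 2 * (real N + 1) * ?y"
          by (simp add: half_def algebra_simps)
        then have "K * (real N + real j + 1) \<le> K * (2 * (real N + 1) * ?y)"
          using K by (rule mult_left_mono)
        then have l: "\<bar>L N j\<bar> \<le> C * ?y"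
          using bound[of N j] by (simp add: C_def mult_ac)
        have cl: "\<bar>cert (real N) ?y * L N j\<bar> \<le> \<bar>cert (real N) ?y\<bar> * (C * ?y)"
          unfolding abs_mult by (intro mult_left_mono l) simp
        have gy: "\<bar>g (real N) ?y\<bar> * 1 \<le> \<bar>g (real N) ?y\<bar> * (2 * ?y)"
          using y by (intro mult_left_mono) auto
        have "\<bar>cert (real N) ?y * L N j + g (real N) ?y\<bar>
            \<le> \<bar>cert (real N) ?y\<bar> * (C * ?y) + \<bar>g (real N) ?y\<bar> * (2 * ?y)"
          using abs_triangle_ineq add_mono[OF cl gy[unfolded mult_1_right]] by (rule order_trans)
        then have "\<bar>G N j\<bar> \<le> B / ?y / ?y\<^sup>2 * (\<bar>cert (real N) ?y\<bar> * (C * ?y) + \<bar>g (real N) ?y\<bar> * (2 * ?y))"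
          unfolding G_def abs_mult using s y BC by (intro mult_mono) auto
        also have "\<dots> = B * (C * \<bar>cert (real N) ?y / ?y\<^sup>2\<bar> + 2 * \<bar>g (real N) ?y / ?y\<^sup>2\<bar>)"
          using y by (simp add: abs_mult divide_simps) (simp add: algebra_simps)
        finally show ?thesis by (simp add: E_def)
      qed
      show ?thesis
      proof (rule Lim_null_comparison)
        show "\<forall>\<^sub>F j in sequentially. norm (G N j) \<le> E j"
          by (rule always_eventually) (simp only: G_le simp_thms)
        show "E \<longlonglongrightarrow> 0" using E_lim by simp
      qed
    qed
  qed
  then show ?thesis by (simp add: G_def half_0)
qed

section \<open>The four closed forms\<close>

text \<open>
  The half-integers are the halves of the odd numbers, so the sum is \<open>2\<^sup>s\<close> times the zeta series
  without its even terms. Pairing consecutive terms of that series separates the two parities.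
\<close>

lemma sums_half_power:
  assumes s: "s \<ge> 2"
  shows "(\<lambda>j. 1 / half j ^ s) sums ((2 ^ s - 1) * zeta (real s))"
proof -
  have eq: "1 / real (Suc n) powr real s = 1 / real (Suc n) ^ s" for n
    by (simp add: powr_realpow)
  have "summable (\<lambda>n. inverse (real n ^ s))"
    using s by (rule inverse_power_summable)
  then have "summable (\<lambda>n. 1 / real (Suc n) ^ s)"
    by (subst (asm) summable_Suc_iff[symmetric]) (simp add: inverse_eq_divide)
  then have z: "(\<lambda>n. 1 / real (Suc n) ^ s) sums zeta (real s)"
    unfolding zeta_def eq by (rule summable_sums)
  have "(\<lambda>j. \<Sum>n\<in>{j * 2..<j * 2 + 2}. 1 / real (Suc n) ^ s) sums zeta (real s)"
    using z by (rule sums_group) simp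
  moreover have "(\<Sum>n\<in>{j * 2..<j * 2 + 2}. 1 / real (Suc n) ^ s)
      = (1 / half j ^ s + 1 / real (Suc j) ^ s) / 2 ^ s" for j
  proof -
    have "{j * 2..<j * 2 + 2} = {2 * j, 2 * j + 1}" by auto
    moreover have "real (Suc (2 * j)) = 2 * half j" "real (Suc (2 * j + 1)) = 2 * real (Suc j)"
      by (auto simp: half_def)
    ultimately show ?thesis
      by (simp add: power_mult_distrib add_divide_distrib mult_ac del: of_nat_Suc)
  qed
  ultimately have "(\<lambda>j. (1 / half j ^ s + 1 / real (Suc j) ^ s) / 2 ^ s) sums zeta (real s)"
    by simp
  from sums_mult[OF this, of "2 ^ s"]
  have "(\<lambda>j. 1 / half j ^ s + 1 / real (Suc j) ^ s) sums (2 ^ s * zeta (real s))"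
    by simp
  from sums_diff[OF this z] show ?thesis
    by (simp add: algebra_simps)
qed

lemma Gamma_reflection_real:
  fixes x :: real
  shows "Gamma x * Gamma (1 - x) = pi / sin (pi * x)"
proof -
  have "complex_of_real (Gamma x * Gamma (1 - x)) = Gamma (complex_of_real x) * Gamma (1 - complex_of_real x)"
    using Gamma_complex_of_real[of "1 - x"] by (simp add: Gamma_complex_of_real)
  also have "\<dots> = complex_of_real pi / sin (complex_of_real pi * complex_of_real x)"
    by (rule Gamma_reflection_complex)
  also have "\<dots> = complex_of_real (pi / sin (pi * x))"
    by (simp only: sin_of_real of_real_mult[symmetric] of_real_divide[symmetric])
  finally show ?thesis by (simp only: of_real_eq_iff)
qed

text \<open>
  Logarithmic differentiation of the reflection formula of the Gamma function.
\<close>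

lemma Digamma_reflection:
  fixes x :: real
  assumes x: "x \<in> {0<..<1}"
  shows "Digamma (1 - x) - Digamma x = pi * cot (pi * x)"
proof -
  have nonpos: "x \<notin> \<int>\<^sub>\<le>\<^sub>0" "1 - x \<notin> \<int>\<^sub>\<le>\<^sub>0"
    using x by (auto elim!: nonpos_Ints_cases)
  have sin: "sin (pi * x) > 0"
    using x by (intro sin_gt_zero) auto
  have "((\<lambda>x. Gamma x * Gamma (1 - x)) has_real_derivative
      Gamma x * Gamma (1 - x) * (Digamma x - Digamma (1 - x))) (at x)"
    using nonpos by (auto intro!: derivative_eq_intros simp: algebra_simps)
  moreover have "((\<lambda>x. Gamma x * Gamma (1 - x)) has_real_derivative
      - (pi * (pi * cos (pi * x))) / (sin (pi * x))\<^sup>2) (at x)"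
    unfolding Gamma_reflection_real
    using sin by (auto intro!: derivative_eq_intros simp: power2_eq_square)
  ultimately have "Gamma x * Gamma (1 - x) * (Digamma x - Digamma (1 - x))
      = - (pi * (pi * cos (pi * x))) / (sin (pi * x))\<^sup>2"
    by (rule DERIV_unique)
  then have "pi * (Digamma x - Digamma (1 - x)) / sin (pi * x)
      = - (pi * cos (pi * x)) * pi / (sin (pi * x))\<^sup>2"
    unfolding Gamma_reflection_real by (simp add: mult_ac)
  then have "pi * ((Digamma x - Digamma (1 - x)) * sin (pi * x)) = pi * (- (pi * cos (pi * x)))"
    using sin by (simp add: divide_simps power2_eq_square)
  then have "(Digamma x - Digamma (1 - x)) * sin (pi * x) = - (pi * cos (pi * x))"
    by (subst (asm) mult_left_cancel) simp_all
  then have "Digamma x - Digamma (1 - x) = - (pi * cos (pi * x)) / sin (pi * x)"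
    using sin by (simp add: divide_simps)
  then show ?thesis by (simp add: cot_def)
qed

lemma derivative_eq_on_unit_interval:
  fixes f g :: "real \<Rightarrow> real"
  assumes eq: "\<And>x. x \<in> {0<..<1} \<Longrightarrow> f x = g x" and x: "x \<in> {0<..<1}"
    and f: "(f has_real_derivative f') (at x)" and g: "(g has_real_derivative g') (at x)"
  shows "f' = g'"
proof (rule DERIV_unique[OF f])
  show "(f has_real_derivative g') (at x)"
    using g by (rule has_field_derivative_transform_within_open[of _ _ _ "{0<..<1}"])
      (use x eq in auto)
qed

text \<open>
  The sum is \<open>Polygamma 3 (1/2) / 6\<close>. Differentiating the reflection formula of the Digamma function
  three times and setting \<open>x = 1/2\<close>, where the two Polygamma terms coincide and the cotangent vanishes,
  determines this value.
\<close>

lemma sums_half_power_4: "(\<lambda>j. 1 / half j ^ 4) sums (pi ^ 4 / 6)"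
proof -
  define c where "c = (\<lambda>x. cot (pi * x))"
  have c': "(c has_real_derivative - (pi * (1 + (c x)\<^sup>2))) (at x)" if "x \<in> {0<..<1}" for x
  proof -
    have "sin (pi * x) > 0" using that by (intro sin_gt_zero) auto
    then have "(c has_real_derivative (- (pi * (sin (pi * x) * sin (pi * x))) - pi * (cos (pi * x) * cos (pi * x)))
        / (sin (pi * x) * sin (pi * x))) (at x)"
      unfolding c_def cot_def by (auto intro!: derivative_eq_intros simp: algebra_simps)
    moreover have "(- (pi * (sin (pi * x) * sin (pi * x))) - pi * (cos (pi * x) * cos (pi * x)))
        / (sin (pi * x) * sin (pi * x)) = - (pi * (1 + (c x)\<^sup>2))"
      using \<open>sin (pi * x) > 0\<close>
      by (simp add: c_def cot_def power2_eq_square diff_divide_distrib algebra_simps)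
    ultimately show ?thesis by simp
  qed
  have nonpos: "x \<notin> \<int>\<^sub>\<le>\<^sub>0" "1 - x \<notin> \<int>\<^sub>\<le>\<^sub>0" if "x \<in> {0<..<1}" for x :: real
    using that by (auto elim!: nonpos_Ints_cases)
  have p: "((\<lambda>x. Polygamma n (1 - x)) has_real_derivative - Polygamma (Suc n) (1 - x)) (at x)"
    "(Polygamma n has_real_derivative Polygamma (Suc n) x) (at x)" if "x \<in> {0<..<1}" for x n
    using nonpos[OF that] by (auto intro!: derivative_eq_intros)
  have d0: "Polygamma 0 (1 - x) - Polygamma 0 x = pi * c x" if "x \<in> {0<..<1}" for x
    unfolding c_def using that by (rule Digamma_reflection)
  have d1: "- Polygamma 1 (1 - x) - Polygamma 1 x = - (pi^2 * (1 + (c x)^2))" if x: "x \<in> {0<..<1}" for x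
    by (rule derivative_eq_on_unit_interval[OF d0 x])
      (use x in \<open>auto intro!: derivative_eq_intros p c' simp: power2_eq_square\<close>)
  have d2: "Polygamma 2 (1 - x) - Polygamma 2 x = 2 * pi^3 * (c x + (c x)^3)" if x: "x \<in> {0<..<1}" for x
    by (rule derivative_eq_on_unit_interval[OF d1 x])
      (use x in \<open>auto intro!: derivative_eq_intros p c' simp: eval_nat_numeral algebra_simps\<close>)
  have d3: "- Polygamma 3 (1 - x) - Polygamma 3 x = - (2 * pi^4 * (1 + 3 * (c x)^2) * (1 + (c x)^2))" if x: "x \<in> {0<..<1}" for x
    by (rule derivative_eq_on_unit_interval[OF d2 x])
      (use x in \<open>auto intro!: derivative_eq_intros p c' simp: eval_nat_numeral algebra_simps\<close>)
  have "c (1 / 2) = 0" by (simp add: c_def cot_def)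
  then have P: "Polygamma 3 (1 / 2 :: real) = pi ^ 4"
    using d3[of "1 / 2"] by simp
  have "summable (\<lambda>k. inverse ((1 / 2 + real k) ^ 4))"
    by (rule Polygamma_converges') auto
  then have "(\<lambda>k. inverse ((1 / 2 + real k) ^ 4)) sums (pi ^ 4 / 6)"
    using P by (simp add: Polygamma_def summable_sums_iff[symmetric] eval_nat_numeral summable_sums sums_iff)
  then show ?thesis by (simp add: half_def inverse_eq_divide add.commute)
qed

text \<open>
  This predicate reduces the behaviour of the certificates along a row to a comparison of degrees,
  with no case distinction on whether a coefficient that depends on \<open>n\<close> vanishes.
\<close>

definition negligible_over :: "nat \<Rightarrow> (real \<Rightarrow> real) \<Rightarrow> bool" where
  "negligible_over m f \<longleftrightarrow> ((\<lambda>y. f y / y ^ m) \<longlongrightarrow> 0) at_top"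

lemma negligible_over_add:
  "negligible_over m f \<Longrightarrow> negligible_over m g \<Longrightarrow> negligible_over m (\<lambda>y. f y + g y)"
  unfolding negligible_over_def add_divide_distrib by (rule tendsto_add_zero)

lemma negligible_over_diff:
  "negligible_over m f \<Longrightarrow> negligible_over m g \<Longrightarrow> negligible_over m (\<lambda>y. f y - g y)"
  unfolding negligible_over_def diff_divide_distrib using tendsto_diff[of _ 0 _ _ 0] by fastforce

lemma negligible_over_monom:
  assumes "k < m"
  shows "negligible_over m (\<lambda>y. y ^ k * a)"
proof -
  have "((\<lambda>y. a * inverse (y ^ (m - k))) \<longlongrightarrow> 0) at_top"
    using assms
    by (intro tendsto_mult_right_zero tendsto_inverse_0_at_top filterlim_pow_at_top filterlim_ident) auto
  moreover have "\<forall>\<^sub>F y in at_top. a * inverse (y ^ (m - k)) = y ^ k * a / (y :: real) ^ m"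
    using eventually_gt_at_top[of 0]
  proof eventually_elim
    case (elim y)
    have "y ^ m = y ^ k * y ^ (m - k)"
      using assms by (simp flip: power_add)
    then show ?case using elim by (simp add: field_simps)
  qed
  ultimately show ?thesis
    unfolding negligible_over_def by (rule Lim_transform_eventually)
qed

lemma negligible_over_linear: "1 < m \<Longrightarrow> negligible_over m (\<lambda>y. y * a)"
  using negligible_over_monom[of 1 m a] by simp

lemma negligible_over_const: "0 < m \<Longrightarrow> negligible_over m (\<lambda>y. a)"
  using negligible_over_monom[of 0 m a] by simp

lemma negligible_over_power: "k < m \<Longrightarrow> negligible_over m (\<lambda>y. y ^ k)"
  using negligible_over_monom[of k m 1] by simp

lemmas negligible_over_intros = negligible_over_power negligible_over_add negligible_over_diff negligible_over_monom
  negligible_over_linear negligible_over_const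

lemma certden_asymp: "((\<lambda>y. y ^ 3 / certden n y) \<longlongrightarrow> 1) at_top"
proof -
  have i: "((\<lambda>y. inverse y) \<longlongrightarrow> (0::real)) at_top"
    by (rule tendsto_inverse_0_at_top) (rule filterlim_ident)
  have "((\<lambda>y. inverse ((1 - (n + 1) * inverse y) * (1 + (3*n + 1) * inverse y) * (1 + (3*n + 2) * inverse y)))
      \<longlongrightarrow> inverse ((1 - (n + 1) * 0) * (1 + (3*n + 1) * 0) * (1 + (3*n + 2) * 0))) at_top"
    by (intro tendsto_intros i) auto
  moreover have "\<forall>\<^sub>F y in at_top. inverse ((1 - (n + 1) * inverse y) * (1 + (3*n + 1) * inverse y)
      * (1 + (3*n + 2) * inverse y)) = y ^ 3 / certden n y"
    using eventually_gt_at_top[of 0]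
  proof eventually_elim
    case (elim y)
    have "certden n y = y ^ 3 * ((1 - (n + 1) * inverse y) * (1 + (3*n + 1) * inverse y)
        * (1 + (3*n + 2) * inverse y))"
    proof -
      have "y - n - 1 = y * (1 - (n + 1) * inverse y)" "y + 3*n + 1 = y * (1 + (3*n + 1) * inverse y)"
        "y + 3*n + 2 = y * (1 + (3*n + 2) * inverse y)"
        using elim by (auto simp: field_simps)
      then show ?thesis unfolding certden_def by (simp only: power3_eq_cube mult_ac)
    qed
    then show ?case using elim by (simp add: inverse_eq_divide)
  qed
  ultimately show ?thesis using Lim_transform_eventually by fastforce
qed

lemma linear_certden_negligible:
  assumes "negligible_over 5 h"
  shows "((\<lambda>y. h y / (a * (certden n y * q)) / y\<^sup>2) \<longlongrightarrow> 0) at_top"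
proof -
  have "((\<lambda>y. h y / y ^ 5 * (y ^ 3 / certden n y) * inverse (a * q)) \<longlongrightarrow> 0 * 1 * inverse (a * q)) at_top"
    using assms unfolding negligible_over_def by (intro tendsto_mult certden_asymp tendsto_const)
  moreover have "h y / y ^ 5 * (y ^ 3 / d) * inverse (a * q) = h y / (a * (d * q)) / y\<^sup>2" for y d :: real
  proof -
    have "inverse (y ^ 5) * y ^ 3 = inverse (y\<^sup>2)" if "y \<noteq> 0"
      using that by (simp add: divide_simps)
    then show ?thesis by (cases "y = 0") (simp_all add: divide_inverse)
  qed
  ultimately show ?thesis by simp
qed

lemma quadratic_certden_negligible:
  assumes "negligible_over 8 h"
  shows "((\<lambda>y. h y / (a * ((certden n y)\<^sup>2 * q)) / y\<^sup>2) \<longlongrightarrow> 0) at_top"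
proof -
  have "((\<lambda>y. h y / y ^ 8 * (y ^ 3 / certden n y)\<^sup>2 * inverse (a * q)) \<longlongrightarrow> 0 * 1\<^sup>2 * inverse (a * q)) at_top"
    using assms unfolding negligible_over_def
    by (intro tendsto_mult tendsto_power certden_asymp tendsto_const)
  moreover have "h y / y ^ 8 * (y ^ 3 / d)\<^sup>2 * inverse (a * q) = h y / (a * (d\<^sup>2 * q)) / y\<^sup>2" for y d :: real
  proof -
    have "inverse (y ^ 8) * y ^ 6 = inverse (y\<^sup>2)" if "y \<noteq> 0"
      using that by (simp add: divide_simps)
    then show ?thesis by (cases "y = 0") (simp_all add: divide_inverse power_mult_distrib power_inverse)
  qed
  ultimately show ?thesis by simp
qed

lemma cert_negligible: "((\<lambda>y. cert n y / y\<^sup>2) \<longlongrightarrow> 0) at_top"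
  unfolding cert_def
  by (rule linear_certden_negligible) (unfold certnum_def, intro negligible_over_intros, auto)

lemma certH1_negligible: "((\<lambda>y. certH1 n y / y\<^sup>2) \<longlongrightarrow> 0) at_top"
  unfolding certH1_def
  by (rule quadratic_certden_negligible) (unfold numH1_def, intro negligible_over_intros, auto)

lemma certC_negligible: "((\<lambda>y. certC n y / y\<^sup>2) \<longlongrightarrow> 0) at_top"
  unfolding certC_def
  by (rule quadratic_certden_negligible) (unfold numC_def, intro negligible_over_intros, auto)

lemma certH2_negligible: "((\<lambda>y. certH2 n y / y\<^sup>2) \<longlongrightarrow> 0) at_top"
  unfolding certH2_def
  by (rule linear_certden_negligible) (unfold numH2_def, intro negligible_over_intros, auto)

lemma certH3_negligible: "((\<lambda>y. certH3 n y / y\<^sup>2) \<longlongrightarrow> 0) at_top"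
proof -
  have "filterlim (\<lambda>y. y + n) at_top at_top"
    by (subst add.commute) (rule filterlim_tendsto_add_at_top[OF tendsto_const filterlim_ident])
  then have i: "((\<lambda>y. inverse (y + n)) \<longlongrightarrow> 0) at_top"
    by (rule tendsto_inverse_0_at_top)
  have neg: "negligible_over 5 (numH3 n)"
    unfolding numH3_def by (intro negligible_over_intros) auto
  have "((\<lambda>y. numH3 n y / (2 * (certden n y * ((2*n+1)*(2*n+2)))) / y\<^sup>2 * inverse (y + n)) \<longlongrightarrow> 0 * 0) at_top"
    by (rule tendsto_mult[OF linear_certden_negligible[OF neg] i])
  moreover have "(\<lambda>y. certH3 n y / y\<^sup>2)
      = (\<lambda>y. numH3 n y / (2 * (certden n y * ((2*n+1)*(2*n+2)))) / y\<^sup>2 * inverse (y + n))"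
    by (rule ext) (simp only: certH3_def divide_inverse inverse_mult_distrib mult_ac)
  ultimately show ?thesis
    by (simp only: mult_zero_left)
qed

lemma inverse_half_shift_le: "\<bar>1 / (half j - real N + real s)\<bar> \<le> 2"
  using half_shift_abs_ge[of j N s] by (simp add: divide_le_eq)

lemma inverse_half_bounds: "0 \<le> 1 / half j" "1 / half j \<le> 2"
  by (auto simp: half_def divide_le_eq)

lemma inverse_half_power_bounds: "0 \<le> 1 / half j ^ k" "1 / half j ^ k \<le> 2 ^ k"
  using power_mono[OF inverse_half_bounds(2), of j k] inverse_half_bounds[of j]
  by (auto simp: power_divide)

lemma H_double_bounds: "0 \<le> H m (2 * N)" "H m (2 * N) \<le> 2 * real N"
  using H_bound[of m "2 * N"] by auto

lemma sum_inverse_half_le: "\<bar>\<Sum>s<m. 1 / (half j - real N + real s)\<bar> \<le> 2 * real m"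
  using sum_abs[of "\<lambda>s. 1 / (half j - real N + real s)" "{..<m}"]
    sum_mono[of "{..<m}" "\<lambda>s. \<bar>1 / (half j - real N + real s)\<bar>" "\<lambda>_. 2"] inverse_half_shift_le[of j N]
  by simp

lemma weightH1_sums: "(\<lambda>N. seed N 0 * (cert (real N) (1/2) * weightH1 N 0 + certH1 (real N) (1/2))) sums (pi ^ 4 / 2)"
proof (rule weighted_sums[OF weightH1_Suc_N weightH1_Suc_j weightH1_wz_ratio])
  show "\<bar>weightH1 N j\<bar> \<le> 6 * (real N + real j + 1)" for N j
  proof -
    have "\<bar>h + 3 / 2 * q + s\<bar> \<le> 6 * (n + m + 1)"
      if "0 \<le> h" "h \<le> 2 * n" "0 \<le> q" "q \<le> 2" "\<bar>s\<bar> \<le> 2 * (2 * n)" "0 \<le> n" "0 \<le> m" for h q s n m :: real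
      using that by (auto simp: abs_le_iff)
    from this[of _ "real N" "1 / half (N + j)" _ "real j"] show ?thesis
      using H_double_bounds[of 1 N] sum_inverse_half_le[of j N "2 * N"] inverse_half_bounds[of "N + j"]
      unfolding weightH1_def half_add[symmetric] by simp
  qed
  show "(\<lambda>j. 2 * weightH1 0 j / half j ^ 3) sums (pi ^ 4 / 2)"
    using sums_mult[OF sums_half_power_4, of 3]
    by (simp add: weightH1_def H_0 eval_nat_numeral)
qed (rule cert_negligible certH1_negligible | assumption)+

lemma weightC_sums: "(\<lambda>N. seed N 0 * (cert (real N) (1/2) * weightC N 0 + certC (real N) (1/2))) sums (pi ^ 4)"
proof (rule weighted_sums[OF weightC_Suc_N weightC_Suc_j weightC_wz_ratio])
  show "\<bar>weightC N j\<bar> \<le> 8 * (real N + real j + 1)" for N j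
  proof -
    have "\<bar>2 * q + s\<bar> \<le> 8 * (n + m + 1)"
      if "0 \<le> q" "q \<le> 2" "\<bar>s\<bar> \<le> 2 * (4 * n + 1)" "0 \<le> n" "0 \<le> m" for q s n m :: real
      using that by (auto simp: abs_le_iff)
    from this[of "1 / half (N + j)" _ "real N" "real j"] show ?thesis
      using sum_inverse_half_le[of j N "4 * N + 1"] inverse_half_bounds[of "N + j"]
      unfolding weightC_def half_add[symmetric] by simp
  qed
  show "(\<lambda>j. 2 * weightC 0 j / half j ^ 3) sums (pi ^ 4)"
    using sums_mult[OF sums_half_power_4, of 6]
    by (simp add: weightC_def add_divide_distrib[symmetric] eval_nat_numeral)
qed (rule cert_negligible certC_negligible | assumption)+

lemma weightH2_sums: "(\<lambda>N. seed N 0 * (cert (real N) (1/2) * weightH2 N 0 + certH2 (real N) (1/2))) sums (- 62 * zeta 5)"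
proof (rule weighted_sums[OF weightH2_Suc_N weightH2_Suc_j weightH2_wz_ratio])
  show "\<bar>weightH2 N j\<bar> \<le> 4 * (real N + real j + 1)" for N j
  proof -
    have "\<bar>h - q\<bar> \<le> 4 * (n + m + 1)"
      if "0 \<le> h" "h \<le> 2 * n" "0 \<le> q" "q \<le> 4" "0 \<le> n" "0 \<le> m" for h q n m :: real
      using that by (auto simp: abs_le_iff)
    from this[of "H 2 (2 * N)" "real N" "1 / (half (N + j))\<^sup>2" "real j"] show ?thesis
      using H_double_bounds[of 2 N] inverse_half_power_bounds[of "N + j" 2]
      unfolding weightH2_def half_add[symmetric] by simp
  qed
  show "(\<lambda>j. 2 * weightH2 0 j / half j ^ 3) sums (- 62 * zeta 5)"
    using sums_mult[OF sums_half_power[of 5], of "-2"]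
    by (simp add: weightH2_def H_0 eval_nat_numeral mult_ac)
qed (rule cert_negligible certH2_negligible | assumption)+

text \<open>
  With the partial sums \<open>T j\<close> of \<open>1 / y\<^sup>3\<close>, the term of the sum on the line \<open>N = 0\<close> is
  \<open>2 (2 T j + 1/y\<^sup>3) / y\<^sup>3 = 2 (T (j+1))\<^sup>2 - 2 (T j)\<^sup>2\<close>. The square of \<open>\<zeta>(3)\<close> arises from
  this telescoping.
\<close>

lemma weightH3_sums: "(\<lambda>N. seed N 0 * (cert (real N) (1/2) * weightH3 N 0 + certH3 (real N) (1/2))) sums (98 * (zeta 3)\<^sup>2)"
proof (rule weighted_sums[OF weightH3_Suc_N weightH3_Suc_j weightH3_wz_ratio])
  show "\<bar>weightH3 N j\<bar> \<le> 18 * (real N + real j + 1)" for N j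
  proof -
    have "\<bar>2 * s + q - h\<bar> \<le> 18 * (n + m + 1)"
      if "0 \<le> h" "h \<le> 2 * n" "0 \<le> q" "q \<le> 8" "0 \<le> s" "s \<le> 8 * (n + m)" "0 \<le> n" "0 \<le> m" for h q s n m :: real
      using that by (auto simp: abs_le_iff)
    note * = this[of "H 3 (2 * N)" "real N" "1 / half (N + j) ^ 3" "\<Sum>i<N + j. 1 / half i ^ 3" "real j"]
    have "0 \<le> (\<Sum>i<N + j. 1 / half i ^ 3)" by (intro sum_nonneg inverse_half_power_bounds)
    moreover have "(\<Sum>i<N + j. 1 / half i ^ 3) \<le> (\<Sum>i<N + j. 2 ^ 3)"
      by (intro sum_mono inverse_half_power_bounds)
    moreover have "0 \<le> 1 / half (N + j) ^ 3" "1 / half (N + j) ^ 3 \<le> 8"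
      using inverse_half_power_bounds[of "N + j" 3] by simp_all
    ultimately show ?thesis
      using H_double_bounds[of 3 N] unfolding weightH3_def half_add[symmetric]
      by (intro *) (simp_all add: distrib_left mult_ac)
  qed
  define T where "T = (\<lambda>j. \<Sum>i<j. 1 / half i ^ 3)"
  have "T \<longlonglongrightarrow> 7 * zeta 3"
    using sums_half_power[of 3] by (simp add: sums_def T_def)
  then have "(\<lambda>j. 2 * (T j)\<^sup>2) \<longlonglongrightarrow> 2 * (7 * zeta 3)\<^sup>2"
    by (intro tendsto_intros)
  from telescope_sums[OF this] have "(\<lambda>j. 2 * (T (Suc j))\<^sup>2 - 2 * (T j)\<^sup>2) sums (98 * (zeta 3)\<^sup>2)"
    by (simp add: T_def power_mult_distrib)
  moreover have "2 * (T (Suc j))\<^sup>2 - 2 * (T j)\<^sup>2 = 2 * weightH3 0 j / half j ^ 3" for j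
    by (simp add: T_def weightH3_def H_0 power2_eq_square algebra_simps add_divide_distrib)
  ultimately show "(\<lambda>j. 2 * weightH3 0 j / half j ^ 3) sums (98 * (zeta 3)\<^sup>2)"
    by simp
qed (rule cert_negligible certH3_negligible | assumption)+

section \<open>Identification of the terms\<close>

text \<open>
  The line \<open>j = 0\<close> carries the terms of the theorem. At \<open>y = 1/2\<close> the certificate \<open>cert\<close> collapses to
  \<open>(86 x\<^sup>2 - 21 x + 2) / (12 x (6 x - 1))\<close> with \<open>x = n + 1\<close>, which is the source of the quadratic factor.
\<close>

lemma certden_half: "certden n (1/2) = - ((2*n+1) * (3 * (2*n+1)) * (6*n+5)) / 8"
  by (simp add: certden_def field_simps)

lemma numerators_half:
  "certnum n (1/2) = - ((2*n+1)^3 * (86*(n+1)^2 - 21*(n+1) + 2)) / 8"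
  "numH1 n (1/2) = 3 * (2*n+1)^4 * (6*n+5) * (25*(n+1)*(6*n+5) - 2*(86*(n+1)^2 - 21*(n+1) + 2)) / 32"
  "numC n (1/2) = (2*n+1)^4 * (3*(6*n+5)*(2*(n+1)*(322*(n+1) - 45) - 50*(n+1)*(6*n+5))
     - (84*n+74)*(86*(n+1)^2 - 21*(n+1) + 2)) / 64"
  "numH2 n (1/2) = - ((2*n+1) * (5*(86*(n+1)^2 - 21*(n+1) + 2) - 61*(n+1)*(6*n+5))) / 8"
  "numH3 n (1/2) = - ((2*n+1) * (7*(86*(n+1)^2 - 21*(n+1) + 2) - 83*(n+1)*(6*n+5))) / 16"
  unfolding certnum_def numH1_def numC_def numH2_def numH3_def
  by (simp_all add: field_simps eval_nat_numeral)

lemma certificates_half: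
  fixes n :: real
  assumes "n \<ge> 0"
  defines "P \<equiv> 86*(n+1)^2 - 21*(n+1) + 2" and "E \<equiv> 12*(n+1)*(6*n+5)"
  shows "cert n (1/2) = P / E"
    and "certH1 n (1/2) = (25*(n+1)*(6*n+5) - 2*P) / ((2*n+1) * E)"
    and "certC n (1/2) = (3*(6*n+5)*(2*(n+1)*(322*(n+1) - 45) - 50*(n+1)*(6*n+5)) - (84*n+74)*P)
        / (3*(6*n+5)*(2*n+1) * E)"
    and "certH2 n (1/2) = (5*P - 61*(n+1)*(6*n+5)) / ((2*n+1)^2 * E)"
    and "certH3 n (1/2) = (7*P - 83*(n+1)*(6*n+5)) / ((2*n+1)^3 * E)"
proof -
  have nz: "2*n+1 \<noteq> 0" "6*n+5 \<noteq> 0" "n+1 \<noteq> 0" using assms(1) by auto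
  have e: "2*n+2 = 2*(n+1)" "1/2 + n = (2*n+1)/2" by auto
  have atoms: "- (a^3 * z) / 8 / (2 * (- (a * (3 * a) * e) / 8 * (a * (2 * x)))) = z / (12*x*e)"
    "3 * a^4 * e * z / 32 / (4 * ((- (a * (3 * a) * e) / 8)\<^sup>2 * (a * (2 * x)))) = z / (a * (12*x*e))"
    "a^4 * z / 64 / (2 * ((- (a * (3 * a) * e) / 8)\<^sup>2 * (a * (2 * x)))) = z / (3*e*a * (12*x*e))"
    "- (a * z) / 8 / (2 * (- (a * (3 * a) * e) / 8 * (a * (2 * x)))) = z / (a^2 * (12*x*e))"
    "- (a * z) / 16 / (2 * (- (a * (3 * a) * e) / 8 * (a * (2 * x)) * (a / 2))) = z / (a^3 * (12*x*e))"
    if "a \<noteq> 0" "e \<noteq> 0" "x \<noteq> 0" for a e x z :: real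
    using that by (simp_all add: field_simps eval_nat_numeral)
  show "cert n (1/2) = P / E"
    unfolding cert_def certden_half numerators_half e P_def E_def by (rule atoms[OF nz])
  show "certH1 n (1/2) = (25*(n+1)*(6*n+5) - 2*P) / ((2*n+1) * E)"
    unfolding certH1_def certden_half numerators_half e P_def E_def by (rule atoms[OF nz])
  show "certC n (1/2) = (3*(6*n+5)*(2*(n+1)*(322*(n+1) - 45) - 50*(n+1)*(6*n+5)) - (84*n+74)*P)
        / (3*(6*n+5)*(2*n+1) * E)"
    unfolding certC_def certden_half numerators_half e P_def E_def by (rule atoms[OF nz])
  show "certH2 n (1/2) = (5*P - 61*(n+1)*(6*n+5)) / ((2*n+1)^2 * E)"
    unfolding certH2_def certden_half numerators_half e P_def E_def by (rule atoms[OF nz])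
  show "certH3 n (1/2) = (7*P - 83*(n+1)*(6*n+5)) / ((2*n+1)^3 * E)"
    unfolding certH3_def certden_half numerators_half e P_def E_def by (rule atoms[OF nz])
qed

lemma inverse_half_rational:
  fixes n :: real
  shows "1 / (1/2 - n - 1) = - 2 / (2*n+1)" "c / (1/2 + n) = 2 * c / (2*n+1)"
    "c / (1/2 + n + 1) = 2 * c / (2*n+3)" "1 / (1/2 + 3*n + 1) = 2 / (6*n+3)"
    "1 / (1/2 + 3*n + 2) = 2 / (6*n+5)" "1 / (1/2 + 3*n + 3) = 2 / (6*n+7)"
proof -
  have e: "1/2 - n - 1 = - ((2*n+1) / 2)" "1/2 + n = (2*n+1) / 2" "(2*n+1) / 2 + 1 = (2*n+3) / 2"
    "1/2 + 3*n + 1 = (6*n+3) / 2" "1/2 + 3*n + 2 = (6*n+5) / 2" "1/2 + 3*n + 3 = (6*n+7) / 2"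
    by (simp_all add: field_simps)
  show "1 / (1/2 - n - 1) = - 2 / (2*n+1)" "c / (1/2 + n) = 2 * c / (2*n+1)"
    "c / (1/2 + n + 1) = 2 * c / (2*n+3)" "1 / (1/2 + 3*n + 1) = 2 / (6*n+3)"
    "1 / (1/2 + 3*n + 2) = 2 / (6*n+5)" "1 / (1/2 + 3*n + 3) = 2 / (6*n+7)"
    unfolding e by (simp_all add: mult_ac)
qed

text \<open>
  At \<open>j = 0\<close> the half-integers \<open>1/2 - N, \<dots>, N - 1/2\<close> cancel in pairs, which removes the last sum of
  \<open>weightH1\<close>.
\<close>

lemma weightH1_at_0: "weightH1 N 0 = H 1 (Suc (2 * N)) + 2 / (2 * real N + 1)"
proof (induction N)
  case 0
  show ?case by (simp add: weightH1_def half_0 H_0 H_Suc)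
next
  case (Suc N)
  have "H 1 (Suc (2 * Suc N)) = H 1 (Suc (2 * N)) + 1 / (2 * real N + 2) + 1 / (2 * real N + 3)"
    by (simp add: H_Suc add_ac)
  then show ?case
    unfolding weightH1_Suc_N Suc half_0 inverse_half_rational
    by (simp add: add_ac)
qed

text \<open>
  The same cancellation leaves the reciprocals of \<open>N + 1/2, \<dots>, 3 N + 1/2\<close>, that is, a difference
  of harmonic sums over odd numbers; this is where \<open>2 H\<^sub>6\<^sub>k\<^sub>-\<^sub>1 - H\<^sub>3\<^sub>k\<^sub>-\<^sub>1\<close> comes from.
\<close>

lemma weightC_at_0:
  "weightC N 0 = 2 * H 1 (6 * N + 5) - H 1 (3 * N + 2) + H 1 N - 2 * H 1 (Suc (2 * N))
     + 6 / (2 * real N + 1) - 2 / (6 * real N + 3) - 2 / (6 * real N + 5)"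
proof (induction N)
  case 0
  show ?case by (simp add: weightC_def half_0 H_0 H_Suc eval_nat_numeral)
next
  case (Suc N)
  have "6 * Suc N + 5 = Suc (Suc (Suc (Suc (Suc (Suc (6 * N + 5))))))" "3 * Suc N + 2 = Suc (Suc (Suc (3 * N + 2)))"
    "2 * Suc N = Suc (Suc (2 * N))" by auto
  then have h: "H 1 (6 * Suc N + 5) = H 1 (6 * N + 5) + 1 / (6 * real N + 6) + 1 / (6 * real N + 7)
        + 1 / (6 * real N + 8) + 1 / (6 * real N + 9) + 1 / (6 * real N + 10) + 1 / (6 * real N + 11)"
    "H 1 (3 * Suc N + 2) = H 1 (3 * N + 2) + 1 / (3 * real N + 3) + 1 / (3 * real N + 4) + 1 / (3 * real N + 5)"
    "H 1 (Suc N) = H 1 N + 1 / (real N + 1)"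
    "H 1 (Suc (2 * Suc N)) = H 1 (Suc (2 * N)) + 1 / (2 * real N + 2) + 1 / (2 * real N + 3)"
    by (simp_all only: H_Suc) (simp_all add: add_ac)
  have "2 * (1 / (6 * n + 6)) = 1 / (3 * n + 3)" "2 * (1 / (6 * n + 8)) = 1 / (3 * n + 4)"
    "2 * (1 / (6 * n + 10)) = 1 / (3 * n + 5)" "2 * (1 / (2 * n + 2)) = 1 / (n + 1)" for n :: real
    by (simp_all add: divide_simps)
  note e = this[of "real N"]
  have s: "2 * real (Suc N) + 1 = 2 * real N + 3" "6 * real (Suc N) + 3 = 6 * real N + 9"
    "6 * real (Suc N) + 5 = 6 * real N + 11" by simp_all
  show ?case
    unfolding weightC_Suc_N Suc half_0 inverse_half_rational h s distrib_left e
    by (simp add: algebra_simps)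
qed

lemma weightH2_at_0: "weightH2 N 0 = H 2 (Suc (2 * N)) - 5 / (2 * real N + 1)\<^sup>2"
proof -
  have "1 / (1/2 + real N)\<^sup>2 = 4 / (2 * real N + 1)\<^sup>2"
    using inverse_half_rational(2)[of 1 "real N"] by (metis (no_types) mult_1_right one_power2
        power_divide power2_eq_square numeral_Bit0_eq_double mult_2 four_x_squared)
  then show ?thesis by (simp add: weightH2_def half_0 H_Suc add_ac)
qed

lemma weightH3_at_0:
  "weightH3 N 0 = 15 * H 3 (Suc (2 * N)) - 2 * H 3 N - 7 / (2 * real N + 1) ^ 3"
proof -
  have c: "1 / (1/2 + n) ^ 3 = 8 / (2 * n + 1) ^ 3" for n :: real
  proof -
    have e: "1/2 + n = (2 * n + 1) / 2" by simp
    show ?thesis unfolding e by (simp add: power_divide)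
  qed
  have "(\<Sum>i<N. 1 / half i ^ 3) = 8 * H 3 (2 * N) - H 3 N"
  proof (induction N)
    case (Suc N)
    have "half N = 1/2 + real N" by (simp add: half_def)
    then have odd: "1 / half N ^ 3 = 8 * (1 / (2 * real N + 1) ^ 3)" by (simp only: c)
    have "2 * real N + 2 = 2 * real (Suc N)" by simp
    then have even: "8 * (1 / (2 * real N + 2) ^ 3) = 1 / real (Suc N) ^ 3"
      by (simp only: power_mult_distrib) simp
    show ?case
      unfolding sum.lessThan_Suc Suc odd H_double_Suc H_Suc[of 3 N] even[symmetric]
      by (simp only: distrib_left)
  qed (simp add: H_0)
  moreover have "weightH3 N 0 = 2 * (\<Sum>i<N. 1 / half i ^ 3) + 8 / (2 * real N + 1) ^ 3 - H 3 (2 * N)"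
    unfolding weightH3_def half_0 c by simp
  ultimately show ?thesis by (simp add: H_Suc add_ac)
qed

definition binomial_product :: "nat \<Rightarrow> real" where
  "binomial_product k = fact (6 * k) / (fact k * fact (2 * k) * fact (3 * k))"

lemma binomial_product_eq: "real ((3 * k) choose k) * real ((6 * k) choose (3 * k)) = binomial_product k"
proof -
  have "3 * k - k = 2 * k" "6 * k - 3 * k = 3 * k" by auto
  then show ?thesis
    unfolding binomial_product_def by (simp add: binomial_fact)
qed

lemma binomial_product_Suc:
  "binomial_product (Suc (Suc N))
     = binomial_product (Suc N) * (12 * (6 * real N + 7) * (6 * real N + 11) / (real N + 2)\<^sup>2)"
proof -
  define k where "k = Suc N"
  have "6 * Suc k = Suc (Suc (Suc (Suc (Suc (Suc (6 * k))))))" "2 * Suc k = Suc (Suc (2 * k))"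
    "3 * Suc k = Suc (Suc (Suc (3 * k)))" by auto
  then have f: "fact (6 * Suc k) = (6*real N+12) * (6*real N+11) * (6*real N+10) * (6*real N+9)
        * (6*real N+8) * (6*real N+7) * fact (6 * k)"
    "fact (2 * Suc k) = (2*real N+4) * (2*real N+3) * fact (2 * k)"
    "fact (3 * Suc k) = (3*real N+6) * (3*real N+5) * (3*real N+4) * fact (3 * k)"
    "fact (Suc k) = (real N+2) * fact k"
    by (simp_all only: fact_Suc of_nat_mult) (simp_all add: k_def add_ac mult_ac)
  have atoms: "6*z * d * (2*y) * (3*b) * (2*w) * c * f6 / (z * f1 * (2*z * b * f2) * (3*z * y * w * f3))
      = f6 / (f1 * f2 * f3) * (12 * c * d / z\<^sup>2)"
    if "z \<noteq> 0" "y \<noteq> 0" "b \<noteq> 0" "w \<noteq> 0" for b c d w y z f1 f2 f3 f6 :: real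
    using that by (simp add: power2_eq_square mult_ac)
  have "(6*n+12) * (6*n+11) * (6*n+10) * (6*n+9) * (6*n+8) * (6*n+7) * f6
      / ((n+2) * f1 * ((2*n+4) * (2*n+3) * f2) * ((3*n+6) * (3*n+5) * (3*n+4) * f3))
      = f6 / (f1 * f2 * f3) * (12 * (6*n+7) * (6*n+11) / (n+2)\<^sup>2)"
    if "n \<ge> 0" for n f1 f2 f3 f6 :: real
  proof -
    have e: "6*n+12 = 6*(n+2)" "6*n+10 = 2*(3*n+5)" "6*n+9 = 3*(2*n+3)" "6*n+8 = 2*(3*n+4)"
      "2*n+4 = 2*(n+2)" "3*n+6 = 3*(n+2)" by auto
    have "n+2 \<noteq> 0" "3*n+5 \<noteq> 0" "2*n+3 \<noteq> 0" "3*n+4 \<noteq> 0" using that by auto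
    then show ?thesis unfolding e by (rule atoms)
  qed
  then show ?thesis
    unfolding binomial_product_def k_def[symmetric] f by simp
qed

lemma ratioN_half:
  assumes "n \<ge> 0"
  shows "ratioN n (1/2) = - (64 * (2*n+1)\<^sup>2 * (n+1)\<^sup>2) / (3 * (2*n+3)\<^sup>2 * (6*n+5) * (6*n+7))"
proof -
  have e: "(2*n+1) / 2 + 1 = (2*n+3) / 2" "1/2 + n = (2*n+1) / 2" "1/2 - n - 1 = - ((2*n+1) / 2)"
    "1/2 + 3*n + 1 = 3*(2*n+1) / 2" "1/2 + 3*n + 2 = (6*n+5) / 2" "1/2 + 3*n + 3 = (6*n+7) / 2"
    "2*n+2 = 2*(n+1)"
    by (simp_all add: field_simps)
  have atoms: "(a * (2 * x))\<^sup>2 * (a/2)\<^sup>2 / ((b/2)\<^sup>2 * (- (a/2)) * (3*a/2) * (c/2) * (d/2))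
      = - (64 * a\<^sup>2 * x\<^sup>2) / (3 * b\<^sup>2 * c * d)" if "a \<noteq> 0" for a b c d x :: real
    using that by (simp add: power2_eq_square mult_ac)
  show ?thesis
    unfolding ratioN_def e using assms by (intro atoms) auto
qed

lemma power_256_eq_seed:
  "(- 256) ^ Suc N
     = - 16 * seed N 0 * ((2 * real N + 1)\<^sup>2 * (real N + 1)\<^sup>2 / (12 * (6 * real N + 5)))
       * binomial_product (Suc N)"
proof (induction N)
  case 0
  show ?case
    by (simp add: seed_def binomial_product_def half_0 eval_nat_numeral)
next
  case (Suc N)
  have atoms: "- 256 * (- 16 * s * (a\<^sup>2 * x\<^sup>2 / (12 * d)) * p)
      = - 16 * (s * (- (64 * a\<^sup>2 * x\<^sup>2) / (3 * b\<^sup>2 * d * c))) * (b\<^sup>2 * z\<^sup>2 / (12 * e))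
        * (p * (12 * c * e / z\<^sup>2))"
    if "b \<noteq> 0" "c \<noteq> 0" "e \<noteq> 0" "z \<noteq> 0" for s a b c d e p x z :: real
    using that by (simp add: field_simps)
  have r: "2 * real (Suc N) + 1 = 2 * real N + 3" "real (Suc N) + 1 = real N + 2"
    "6 * real (Suc N) + 5 = 6 * real N + 11" by auto
  have "(- 256) ^ Suc (Suc N) = - 256 * ((- 256) ^ Suc N :: real)" by simp
  then show ?case
    unfolding Suc seed_Suc_N half_0 ratioN_half[OF of_nat_0_le_iff] binomial_product_Suc r
    by (simp only:) (rule atoms; simp)
qed

text \<open>
  Every term of the four series has this shape with its own \<open>Z\<close>. The constant \<open>- 16\<close> relates the
  series of the theorem to the row \<open>j = 0\<close> of the companion \<open>G\<close>.
\<close>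

lemma term_eq_seed:
  "(- 256) ^ Suc N * Z / ((2 * real (Suc N) - 1)\<^sup>2 * real (Suc N) ^ 3
      * real ((3 * Suc N) choose Suc N) * real ((6 * Suc N) choose (3 * Suc N)))
    = - 16 * (seed N 0 * (Z / (12 * (real N + 1) * (6 * real N + 5))))"
proof -
  have atoms: "- 16 * s * (a\<^sup>2 * x\<^sup>2 / (12 * e)) * p * Z / (a\<^sup>2 * x ^ 3 * p) = - 16 * (s * (Z / (12 * x * e)))"
    if "a \<noteq> 0" "x \<noteq> 0" "p \<noteq> 0" for s a x e p :: real
    using that by (simp add: power2_eq_square power3_eq_cube)
  have "binomial_product (Suc N) \<noteq> 0"
    by (simp add: binomial_product_def)
  moreover have "2 * real N + 1 \<noteq> 0" "real N + 1 \<noteq> 0" by auto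
  moreover have "real (Suc N) = real N + 1" "2 * (real N + 1) - 1 = 2 * real N + 1" by auto
  ultimately show ?thesis
    unfolding power_256_eq_seed mult.assoc[of _ "real ((3 * Suc N) choose Suc N)"] binomial_product_eq
    by (simp only: atoms not_False_eq_True)
qed

theorem theorem1p10:
  shows "((\<lambda>i. let k = Suc i; x = real k in
           (- 256) ^ k
             * ((86 * x\<^sup>2 - 21 * x + 2) * H 1 (2 * k - 1)
                + 25 * x * (6 * x - 1) / (2 * x - 1))
           / ((2 * x - 1)\<^sup>2 * x ^ 3 * real ((3 * k) choose k) * real ((6 * k) choose (3 * k))))
         sums (- 8 * pi ^ 4))
    \<and> ((\<lambda>i. let k = Suc i; x = real k;
               c = 2 * H 1 (6 * k - 1) - H 1 (3 * k - 1) + H 1 (k - 1) in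
           (- 256) ^ k
             * ((86 * x\<^sup>2 - 21 * x + 2) * c
                + 2 * x * (322 * x - 45) / (2 * x - 1))
           / ((2 * x - 1)\<^sup>2 * x ^ 3 * real ((3 * k) choose k) * real ((6 * k) choose (3 * k))))
         sums (- 32 * pi ^ 4))
    \<and> ((\<lambda>i. let k = Suc i; x = real k in
           (- 256) ^ k
             * ((86 * x\<^sup>2 - 21 * x + 2) * H 2 (2 * k - 1)
                - 61 * x * (6 * x - 1) / (2 * x - 1)\<^sup>2)
           / ((2 * x - 1)\<^sup>2 * x ^ 3 * real ((3 * k) choose k) * real ((6 * k) choose (3 * k))))
         sums (992 * zeta 5))
    \<and> ((\<lambda>i. let k = Suc i; x = real k in
           (- 256) ^ k
             * ((86 * x\<^sup>2 - 21 * x + 2) * (15 * H 3 (2 * k - 1) - 2 * H 3 (k - 1))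
                - 83 * x * (6 * x - 1) / (2 * x - 1) ^ 3)
           / ((2 * x - 1)\<^sup>2 * x ^ 3 * real ((3 * k) choose k) * real ((6 * k) choose (3 * k))))
         sums (- 1568 * (zeta 3)\<^sup>2))"
proof -
  have idx: "2 * Suc N - 1 = Suc (2 * N)" "6 * Suc N - 1 = 6 * N + 5" "3 * Suc N - 1 = 3 * N + 2"
    "Suc N - 1 = N" for N by auto
  have x: "real (Suc N) = real N + 1" "6 * (real N + 1) - 1 = 6 * real N + 5"
    "2 * (real N + 1) - 1 = 2 * real N + 1" for N by auto
  have nz: "2 * real N + 1 \<noteq> 0" "real N + 1 \<noteq> 0" "6 * real N + 5 \<noteq> 0" for N
    by auto
  note cert = certificates_half[OF of_nat_0_le_iff]
  have t1: "cert (real N) (1/2) * weightH1 N 0 + certH1 (real N) (1/2)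
      = ((86 * (real N + 1)\<^sup>2 - 21 * (real N + 1) + 2) * H 1 (Suc (2 * N)) + 25 * (real N + 1) * (6 * real N + 5) / (2 * real N + 1))
        / (12 * (real N + 1) * (6 * real N + 5))" for N
  proof -
    have "p / (12*x*e) * (h + 2 / a) + (25*x*e - 2*p) / (a * (12*x*e)) = (p * h + 25*x*e / a) / (12*x*e)"
      if "a \<noteq> 0" "x \<noteq> 0" "e \<noteq> 0" for p h a x e :: real
      using that by (simp add: divide_simps) (simp add: algebra_simps)
    from this[OF nz] show ?thesis unfolding weightH1_at_0 cert .
  qed
  have t3: "cert (real N) (1/2) * weightH2 N 0 + certH2 (real N) (1/2)
      = ((86 * (real N + 1)\<^sup>2 - 21 * (real N + 1) + 2) * H 2 (Suc (2 * N)) - 61 * (real N + 1) * (6 * real N + 5) / (2 * real N + 1)\<^sup>2)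
        / (12 * (real N + 1) * (6 * real N + 5))" for N
  proof -
    have "p / (12*x*e) * (h - 5 / a\<^sup>2) + (5*p - 61*x*e) / (a\<^sup>2 * (12*x*e)) = (p * h - 61*x*e / a\<^sup>2) / (12*x*e)"
      if "a \<noteq> 0" "x \<noteq> 0" "e \<noteq> 0" for p h a x e :: real
      using that by (simp add: divide_simps) (simp add: algebra_simps)
    from this[OF nz] show ?thesis unfolding weightH2_at_0 cert .
  qed
  have t4: "cert (real N) (1/2) * weightH3 N 0 + certH3 (real N) (1/2)
      = ((86 * (real N + 1)\<^sup>2 - 21 * (real N + 1) + 2) * (15 * H 3 (Suc (2 * N)) - 2 * H 3 N)
          - 83 * (real N + 1) * (6 * real N + 5) / (2 * real N + 1) ^ 3)
        / (12 * (real N + 1) * (6 * real N + 5))" for N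
  proof -
    have "p / (12*x*e) * (h - 7 / a ^ 3) + (7*p - 83*x*e) / (a ^ 3 * (12*x*e)) = (p * h - 83*x*e / a ^ 3) / (12*x*e)"
      if "a \<noteq> 0" "x \<noteq> 0" "e \<noteq> 0" for p h a x e :: real
      using that by (simp add: divide_simps) (simp add: algebra_simps)
    from this[OF nz] show ?thesis unfolding weightH3_at_0 cert .
  qed
  \<comment> \<open>The weight \<open>c\<^sub>k\<close> belongs to the direction \<open>- 3 \<partial>\<^sub>\<alpha> - 2 \<partial>\<^sub>\<sigma>\<close>, hence \<open>2 weightH1 + weightC\<close>.\<close>
  have t2: "2 * (cert (real N) (1/2) * weightH1 N 0 + certH1 (real N) (1/2))
        + (cert (real N) (1/2) * weightC N 0 + certC (real N) (1/2))
      = ((86 * (real N + 1)\<^sup>2 - 21 * (real N + 1) + 2) * (2 * H 1 (6 * N + 5) - H 1 (3 * N + 2) + H 1 N)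
          + 2 * (real N + 1) * (322 * (real N + 1) - 45) / (2 * real N + 1))
        / (12 * (real N + 1) * (6 * real N + 5))" for N
  proof -
    have "2 * (p / E * (h + 2 / a) + (25*x*e - 2*p) / (a * E))
        + (p / E * (c - 2 * h + 6 / a - 2 / (3*a) - 2 / e) + (3*e*(w - 50*x*e) - (16*e - 6*a)*p) / (3*e*a*E))
        = (p * c + w / a) / E"
      if "a \<noteq> 0" "e \<noteq> 0" "E \<noteq> 0" for p h a x e c w E :: real
      using that by (simp add: divide_simps) (simp add: algebra_simps)
    note * = this[OF nz(1)[of N] nz(3)[of N], of "12 * (real N + 1) * (6 * real N + 5)"]
    have e: "16 * (6 * real N + 5) - 6 * (2 * real N + 1) = 84 * real N + 74"
      "6 * real N + 3 = 3 * (2 * real N + 1)" by auto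
    show ?thesis unfolding weightH1_at_0 weightC_at_0 cert e(2)
      by (rule *[unfolded e(1)]) (use nz[of N] in auto)
  qed
  have s1: "(\<lambda>N. - 16 * (seed N 0 * (cert (real N) (1/2) * weightH1 N 0 + certH1 (real N) (1/2))))
      sums (- 8 * pi ^ 4)"
    using sums_mult[OF weightH1_sums, of "-16"] by simp
  have s2: "(\<lambda>N. - 16 * (seed N 0 * (2 * (cert (real N) (1/2) * weightH1 N 0 + certH1 (real N) (1/2))
        + (cert (real N) (1/2) * weightC N 0 + certC (real N) (1/2))))) sums (- 32 * pi ^ 4)"
    using sums_mult[OF sums_add[OF sums_mult[OF weightH1_sums, of 2] weightC_sums], of "-16"]
    by (simp add: distrib_left mult_ac)
  have s3: "(\<lambda>N. - 16 * (seed N 0 * (cert (real N) (1/2) * weightH2 N 0 + certH2 (real N) (1/2))))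
      sums (992 * zeta 5)"
    using sums_mult[OF weightH2_sums, of "-16"] by simp
  have s4: "(\<lambda>N. - 16 * (seed N 0 * (cert (real N) (1/2) * weightH3 N 0 + certH3 (real N) (1/2))))
      sums (- 1568 * (zeta 3)\<^sup>2)"
    using sums_mult[OF weightH3_sums, of "-16"] by simp
  show ?thesis
    unfolding Let_def term_eq_seed idx unfolding x
    using s1[unfolded t1] s2[unfolded t2] s3[unfolded t3] s4[unfolded t4]
    by (intro conjI)
qed

end
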